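(* Let $\mu$ and $\mathcal{D}=\{\mathcal{D}_j\}_{j=1}^m$ be probability measures on $\mathbb{R}^d$ with finite second moments satisfying the following assumptions. (A1) The measures $\mathcal{D}_1,\dots,\mathcal{D}_m$ and $\mu$ are absolutely continuous and are all supported on a common set $\Omega$, which is either all of $\mathbb{R}^d$ or a bounded open convex subset of $\mathbb{R}^d$. (A2) The measures $\mathcal{D}_1,\dots,\mathcal{D}_m$ and $\mu$ have respective densities $g_1,\dots,g_m$ and $g$ which are bounded above, and $g_1,\dots,g_m$ are strictly positive on $\Omega$. (A3) If $\Omega=\mathbb{R}^d$, then $g_1,\dots,g_m$ and $g$ are locally Hölder continuous; otherwise $g_1,\dots,g_m$ and $g$ are bounded away from zero on $\Omega$. Let $\mathbf{c}\in\mathbb{R}^m$ and $\mathbf{A}\in\mathbb{R}^{m\times m}$ be the vector and matrix determined by $\mu$ and $\{\mathcal{D}_j\}_{j=1}^m$ through $$c_j=W_2^2(\mathcal{D}_j,\mu),\qquad A_{j\ell}=\int_{\mathbb{R}^d}\langle T_j(\mathbf{x})-\mathbf{x},\,T_\ell(\mathbf{x})-\mathbf{x}\rangle\,d\mu(\mathbf{x}),$$ where $T_j$ is the optimal transport map from $\mu$ to $\mathcal{D}_j$. Then the solutions of $$\operatorname*{arg\,min}_{\boldsymbol{\lambda}\in\Delta^m}\ \sum_{j=1}^m\lambda_j W_2^2(\mathcal{D}_j,\mu)\quad\text{subject to}\quad \mu=\mathrm{Bary}(\mathcal{D},\boldsymbol{\lambda})$$ are given by $$\operatorname*{arg\,min}_{\boldsymbol{\lambda}\in\Delta^m}\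 \boldsymbol{\lambda}^T\mathbf{c}\quad\text{subject to}\quad \mathbf{A}\boldsymbol{\lambda}=\mathbf{0},$$ that is, the two sets of minimizers coincide.
   Context: $\Delta^m=\{\boldsymbol{\lambda}\in\mathbb{R}^m : \sum_{i=1}^m\lambda_i=1,\ \lambda_i\ge 0 \text{ for all } i\}$ is the probability simplex. $\mathcal{P}(\mathbb{R}^d)$ is the space of probability measures on $\mathbb{R}^d$. For $\mu,\nu\in\mathcal{P}(\mathbb{R}^d)$, $\Pi(\mu,\nu)$ is the set of probability measures on $\mathbb{R}^d\times\mathbb{R}^d$ with marginals $\mu$ and $\nu$, and $W_2^2(\mu,\nu)=\min_{\pi\in\Pi(\mu,\nu)}\int\|\mathbf{x}-\mathbf{y}\|_2^2\,d\pi(\mathbf{x},\mathbf{y})$. The Wasserstein-2 barycenter of $\mathcal{D}=\{\mathcal{D}_j\}_{j=1}^m$ (measures with finite second moments) with weights $\boldsymbol{\lambda}\in\Delta^m$ is $$\mathrm{Bary}(\mathcal{D},\boldsymbol{\lambda})=\operatorname*{arg\,min}_{\nu\in\mathcal{P}(\mathbb{R}^d)}\sum_{j=1}^m\lambda_jW_2^2(\mathcal{D}_j,\nu).$$ For absolutely continuous $\mu$ with finite second moment, the optimal transport map from $\mu$ to $\mathcal{D}_j$ is the ($\mu$-a.e. unique) map $T_j$ with pushforward $(T_j)_\#\mu=\mathcal{D}_j$ and $W_2^2(\mu,\mathcal{D}_j)=\int\|T_j(\mathbf{x})-\mathbf{x}\|_2^2\,d\mu(\mathbf{x})$. *)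

theory Defs
  imports "HOL-Probability.Probability"
begin

text \<open>\<^term>\<open>0 powr a = (0::real)\<close>, so the points \<^term>\<open>y = z\<close> cause no trouble. The
  exponent and the constant may depend on the neighbourhood.\<close>

definition locally_Hoelder :: "('a::metric_space \<Rightarrow> real) \<Rightarrow> bool" where
  "locally_Hoelder f \<longleftrightarrow>
     (\<forall>x. \<exists>r>0. \<exists>\<alpha>>0. \<alpha> \<le> 1 \<and>
        (\<exists>C. \<forall>y\<in>ball x r. \<forall>z\<in>ball x r. \<bar>f y - f z\<bar> \<le> C * dist y z powr \<alpha>))"

definition prob_measures :: "'a::topological_space measure set" where
  "prob_measures = {M. prob_space M \<and> sets M = sets borel}"

definition finite_second_moment :: "'a::real_normed_vector measure \<Rightarrow> bool" where
  "finite_second_moment M \<longleftrightarrow> integrable M (\<lambda>x. (norm x)\<^sup>2)"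

definition measure_support :: "'a::topological_space measure \<Rightarrow> 'a set" where
  "measure_support M = {x. \<forall>U. open U \<and> x \<in> U \<longrightarrow> emeasure M U > 0}"

text \<open>\<open>\<Omega>\<close> is an open set, whereas the topological support is closed; ``supported on \<open>\<Omega>\<close>''
  means that \<open>M\<close> lives on \<open>\<Omega>\<close> and that all of \<open>\<Omega>\<close> lies in the support.  For \<open>\<Omega> = UNIV\<close> only the
  second part has content.\<close>

definition supported_on :: "'a::topological_space measure \<Rightarrow> 'a set \<Rightarrow> bool" where
  "supported_on M \<Omega> \<longleftrightarrow> (AE x in M. x \<in> \<Omega>) \<and> \<Omega> \<subseteq> measure_support M"

text \<open>On second countable spaces, such as Euclidean ones, \<^term>\<open>borel\<close> on the product type is the
  product sigma-algebra (\<open>borel_prod\<close>).\<close>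

definition couplings ::
    "'a::euclidean_space measure \<Rightarrow> 'a measure \<Rightarrow> ('a \<times> 'a) measure set" where
  "couplings \<mu> \<nu> =
     {\<pi>\<in>prob_measures. distr \<pi> borel fst = \<mu> \<and> distr \<pi> borel snd = \<nu>}"

text \<open>The squared Wasserstein-2 distance, with value \<open>\<infinity>\<close> allowed because barycenters are minimizers
  over all probability measures, without a moment condition.  The minimum over couplings is attained,
  so it is the infimum.\<close>

definition W2sq :: "'a::euclidean_space measure \<Rightarrow> 'a measure \<Rightarrow> ennreal" where
  "W2sq \<mu> \<nu> = (INF \<pi>\<in>couplings \<mu> \<nu>. \<integral>\<^sup>+ (x, y). ennreal ((norm (x - y))\<^sup>2) \<partial>\<pi>)"

definition optimal_transport_map ::
    "'a::euclidean_space measure \<Rightarrow> 'a measure \<Rightarrow> ('a \<Rightarrow> 'a) \<Rightarrow> bool" where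
  "optimal_transport_map \<mu> \<nu> T \<longleftrightarrow>
     T \<in> borel_measurable \<mu> \<and> distr \<mu> borel T = \<nu> \<and>
     W2sq \<mu> \<nu> = (\<integral>\<^sup>+ x. ennreal ((norm (T x - x))\<^sup>2) \<partial>\<mu>)"

definition prob_simplex :: "(real ^ 'm) set" where
  "prob_simplex = {l. (\<Sum>i\<in>UNIV. l $ i) = 1 \<and> (\<forall>i. 0 \<le> l $ i)}"

definition argmin_set :: "('b \<Rightarrow> 'c::ord) \<Rightarrow> 'b set \<Rightarrow> 'b set" where
  "argmin_set f S = {x. is_arg_min f (\<lambda>y. y \<in> S) x}"

definition Bary ::
    "('m::finite \<Rightarrow> 'a::euclidean_space measure) \<Rightarrow> real ^ 'm \<Rightarrow> 'a measure set" where
  "Bary D l = argmin_set (\<lambda>\<nu>. \<Sum>j\<in>UNIV. ennreal (l $ j) * W2sq (D j) \<nu>) prob_measures"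

end

theory Submission
  imports Defs
begin

text \<open>
  Write \<open>S = (\<Sum>j. \<lambda>\<^sub>j T\<^sub>j)\<close>.  As \<open>A\<close> is a Gram matrix and the weights sum to 1, \<open>A \<lambda> = 0\<close> holds iff
  \<open>S = id\<close> almost everywhere for \<open>\<mu>\<close>; so it suffices that this is equivalent to \<open>\<mu>\<close> being the unique
  barycenter.  If \<open>\<mu>\<close> is a barycenter, comparing it with \<open>S\<^sub># \<mu>\<close> through the couplings
  \<open>(T\<^sub>j, S)\<^sub># \<mu>\<close> gives \<open>\<integral> \<parallel>S x - x\<parallel>\<^sup>2 d\<mu> \<le> 0\<close>.

  Conversely, let \<open>S = id\<close> almost everywhere.  Each \<open>T\<^sub>j\<close> is cyclically monotone on a set of full
  measure, dense in \<open>\<Omega>\<close>, hence a selection of the subdifferential of a convex potential \<open>\<phi>\<^sub>j\<close>.  The function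
  \<open>G = (\<Sum>j. \<lambda>\<^sub>j \<phi>\<^sub>j) - \<parallel>\<cdot>\<parallel>\<^sup>2 / 2\<close> satisfies \<open>G z \<ge> G x - \<parallel>z - x\<parallel>\<^sup>2 / 2\<close> for \<open>x\<close> in a dense set, so it is constant
  on \<open>\<Omega>\<close>; it is at most this constant elsewhere.  With conjugates \<open>\<psi>\<^sub>j\<close> on
  \<open>\<Omega>\<close>, this bounds the cost of any couplings of the \<open>D\<^sub>j\<close> with \<open>\<nu>\<close> from below by the value at \<open>\<mu>\<close> plus
  twice the weighted integrals of the slacks \<open>\<phi>\<^sub>j z + \<psi>\<^sub>j y - \<langle>y, z\<rangle> \<ge> 0\<close>.

  For uniqueness, fix \<open>k\<close> with \<open>\<lambda>\<^sub>k > 0\<close>.  Nearly optimal couplings of \<open>D\<^sub>k\<close> with a minimizer have small slack,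
  which confines \<open>z\<close> to within the second difference quotients of \<open>\<psi>\<^sub>k\<close> of its first difference quotients at
  \<open>y\<close>.  The second difference quotients tend to 0 locally in \<open>L\<^sup>1\<close>, and \<open>D\<^sub>k\<close> has a bounded density, so the
  integral of every bounded Lipschitz function against the minimizer is determined by \<open>\<psi>\<^sub>k\<close> and \<open>D\<^sub>k\<close>.
\<close>

section \<open>Cyclical monotonicity of optimal maps\<close>

text \<open>Every point off the support has a basic open neighbourhood of measure zero, and a
  countable basis leaves only countably many null sets to unite.\<close>

lemma AE_in_measure_support:
  fixes M :: "'a::second_countable_topology measure"
  assumes [simp]: "sets M = sets borel"
  shows "AE x in M. x \<in> measure_support M"
proof -
  obtain B :: "'a set set" where B: "countable B" "topological_basis B"
    using ex_countable_basis by blast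
  have "(\<Union>b\<in>{b\<in>B. emeasure M b = 0}. b) \<in> null_sets M"
    using B by (intro null_sets_UN') (auto simp: null_sets_def dest: topological_basis_open)
  moreover have "{x \<in> space M. x \<notin> measure_support M} \<subseteq> (\<Union>b\<in>{b\<in>B. emeasure M b = 0}. b)"
  proof
    fix x assume "x \<in> {x \<in> space M. x \<notin> measure_support M}"
    then obtain U where U: "open U" "x \<in> U" "emeasure M U = 0"
      by (auto simp: measure_support_def)
    then obtain b where b: "b \<in> B" "x \<in> b" "b \<subseteq> U"
      using B(2) by (meson topological_basisE)
    then have "emeasure M b = 0"
      using U emeasure_mono[of b U M] by simp
    with b show "x \<in> (\<Union>b\<in>{b\<in>B. emeasure M b = 0}. b)" by auto
  qed
  ultimately show ?thesis by (rule AE_I')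
qed

lemma emeasure_distr_nn_integral:
  assumes f: "f \<in> measurable M N" and A: "A \<in> sets N"
  shows "emeasure (distr M N f) A = (\<integral>\<^sup>+ x. indicator A (f x) \<partial>M)"
proof -
  have "emeasure (distr M N f) A = (\<integral>\<^sup>+ y. indicator A y \<partial>distr M N f)"
    using A by simp
  also have "\<dots> = (\<integral>\<^sup>+ x. indicator A (f x) \<partial>M)"
    using assms by (intro nn_integral_distr) auto
  finally show ?thesis .
qed

lemma borel_measurable_fst_snd [measurable]:
  "fst \<in> borel_measurable (borel :: ('a::topological_space \<times> 'b::topological_space) measure)"
  "snd \<in> borel_measurable (borel :: ('a::topological_space \<times> 'b::topological_space) measure)"
  by (intro borel_measurable_continuous_onI continuous_intros)+

text \<open>The cycle runs through \<open>p 0, ..., p n\<close> and is closed by the last summand.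
  All values of the total sequence \<open>p\<close> are required to lie in \<open>N\<close>, which
  spares index bounds: a finite cycle in \<open>N\<close> always extends to such a sequence.\<close>

definition cyclically_monotone_on :: "'a::real_inner set \<Rightarrow> ('a \<Rightarrow> 'a) \<Rightarrow> bool" where
  "cyclically_monotone_on N T \<longleftrightarrow> (\<forall>p (n::nat). (\<forall>i. p i \<in> N) \<longrightarrow>
     (\<Sum>i<n. T (p i) \<bullet> (p (Suc i) - p i)) + T (p n) \<bullet> (p 0 - p n) \<le> 0)"

lemma cyclically_monotone_on_subset:
  "cyclically_monotone_on N T \<Longrightarrow> N' \<subseteq> N \<Longrightarrow> cyclically_monotone_on N' T"
  unfolding cyclically_monotone_on_def by blast

lemma prob_measuresD:
  assumes "M \<in> prob_measures"
  shows "prob_space M" "sets M = sets borel" "space M = UNIV"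
  using assms sets_eq_imp_space_eq[of M borel] by (auto simp: prob_measures_def)

text \<open>\<open>P\<close> is the law of \<open>X i w\<close> for an index \<open>i\<close>
  uniform on \<open>I\<close> and independent of \<open>w\<close>. Describing it by its integrals
  gives both marginals and the cost of the competitor below from one formula.\<close>

lemma nn_integral_average:
  assumes I: "finite I" "I \<noteq> {}"
    and Q: "prob_space Q"
    and X: "\<And>i. i \<in> I \<Longrightarrow> X i \<in> measurable Q (borel :: 'b::topological_space measure)"
  obtains P where "P \<in> prob_measures"
    "\<And>f. f \<in> borel_measurable borel \<Longrightarrow>
       (\<integral>\<^sup>+ z. f z \<partial>P) = (\<integral>\<^sup>+ w. (\<Sum>i\<in>I. f (X i w)) / of_nat (card I) \<partial>Q)"
proof -
  interpret Q: prob_space Q by fact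
  define U where "U = uniform_count_measure I"
  interpret U: prob_space U
    unfolding U_def using I by (rule prob_space_uniform_count_measure)
  interpret UQ: pair_prob_space U Q ..
  have setsU: "sets U = sets (count_space I)" "space U = I"
    by (auto simp: U_def sets_uniform_count_measure space_uniform_count_measure)
  have m: "(\<lambda>(i, w). X i w) \<in> measurable (U \<Otimes>\<^sub>M Q) borel"
  proof -
    have "(\<lambda>(i, w). X i w) \<in> measurable (count_space I \<Otimes>\<^sub>M Q) borel"
      using I X by (intro measurable_pair_measure_countable1) (auto simp: countable_finite)
    also have "measurable (count_space I \<Otimes>\<^sub>M Q) borel = measurable (U \<Otimes>\<^sub>M Q) (borel :: 'b measure)"
      by (intro measurable_cong_sets sets_pair_measure_cong) (auto simp: setsU)
    finally show ?thesis .
  qed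
  define P where "P = distr (U \<Otimes>\<^sub>M Q) borel (\<lambda>(i, w). X i w)"
  show thesis
  proof (rule that)
    show "P \<in> prob_measures"
      unfolding prob_measures_def P_def using UQ.prob_space_distr[OF m] by simp
    fix f :: "'b \<Rightarrow> ennreal" assume f: "f \<in> borel_measurable borel"
    have "(\<integral>\<^sup>+ z. f z \<partial>P) = (\<integral>\<^sup>+ q. f ((\<lambda>(i, w). X i w) q) \<partial>(U \<Otimes>\<^sub>M Q))"
      unfolding P_def by (rule nn_integral_distr[OF m]) (simp add: f)
    also have "\<dots> = (\<integral>\<^sup>+ w. \<integral>\<^sup>+ i. f (X i w) \<partial>U \<partial>Q)"
      using UQ.nn_integral_snd[of "\<lambda>q. f ((\<lambda>(i, w). X i w) q)"] measurable_compose[OF m f] by simp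
    also have "\<dots> = (\<integral>\<^sup>+ w. (\<Sum>i\<in>I. f (X i w)) / of_nat (card I) \<partial>Q)"
    proof (rule nn_integral_cong)
      fix w
      have "(\<integral>\<^sup>+ i. f (X i w) \<partial>U) = (\<Sum>i\<in>I. f (X i w) * ennreal (1 / card I))"
        using I by (simp add: U_def uniform_count_measure_def nn_integral_point_measure_finite mult.commute)
      also have "\<dots> = (\<Sum>i\<in>I. f (X i w)) / of_nat (card I)"
        using I by (simp add: sum_distrib_right[symmetric] divide_ennreal_def
            ennreal_of_nat_eq_real_of_nat inverse_ennreal card_gt_0_iff inverse_eq_divide)
      finally show "(\<integral>\<^sup>+ i. f (X i w) \<partial>U) = (\<Sum>i\<in>I. f (X i w)) / of_nat (card I)" .
    qed
    finally show "(\<integral>\<^sup>+ z. f z \<partial>P) = (\<integral>\<^sup>+ w. (\<Sum>i\<in>I. f (X i w)) / of_nat (card I) \<partial>Q)" .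
  qed
qed

text \<open>
  Competitor: draw i.i.d. points from \<open>\<mu>\<close>, permute them cyclically if that lowers the total cost of
  the pairs \<open>(w i, T (w i))\<close>, and output a pair with uniformly random index.  The permutation leaves the
  averaged marginals unchanged, so no densities have to be rebalanced.
\<close>

lemma optimal_transport_map_cyclic:
  fixes \<mu> :: "'a::euclidean_space measure"
  assumes \<mu>: "\<mu> \<in> prob_measures" and fin: "W2sq \<mu> \<nu> < \<infinity>"
    and T: "optimal_transport_map \<mu> \<nu> T"
  shows "\<exists>N. (AE x in \<mu>. x \<in> N) \<and> cyclically_monotone_on N T"
proof -
  interpret \<mu>: prob_space \<mu> using \<mu> by (rule prob_measuresD)
  have [simp, measurable_cong]: "sets \<mu> = sets borel" and [simp]: "space \<mu> = UNIV"
    using \<mu> by (auto dest: prob_measuresD)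
  have Tm[measurable]: "T \<in> borel_measurable borel"
    using T unfolding optimal_transport_map_def measurable_cong_sets[OF \<open>sets \<mu> = _\<close> refl] by simp
  have Tm': "T \<in> borel_measurable \<mu>" by simp
  have d\<nu>: "distr \<mu> borel T = \<nu>" and cost: "W2sq \<mu> \<nu> = (\<integral>\<^sup>+ x. ennreal ((norm (T x - x))\<^sup>2) \<partial>\<mu>)"
    using T by (auto simp: optimal_transport_map_def)
  have graph_m: "(\<lambda>x. (x, T x)) \<in> borel_measurable \<mu>" by measurable
  \<comment> \<open>Choosing \<open>N\<close> through the support of the graph measure, rather than
    of \<open>\<mu>\<close>, makes every neighbourhood of a graph point over \<open>N\<close> carry
    mass, although \<open>T\<close> need not be continuous.\<close>
  define \<Gamma> where "\<Gamma> = distr \<mu> borel (\<lambda>x. (x, T x))"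
  define N where "N = {x. (x, T x) \<in> measure_support \<Gamma>}"
  have "AE z in \<Gamma>. z \<in> measure_support \<Gamma>"
    by (rule AE_in_measure_support) (simp add: \<Gamma>_def)
  then have "AE x in \<mu>. (x, T x) \<in> measure_support \<Gamma>"
    unfolding \<Gamma>_def by (rule AE_distrD[where M' = borel, rotated]) simp
  then have "AE x in \<mu>. x \<in> N" by (simp add: N_def)
  moreover have "cyclically_monotone_on N T"
    unfolding cyclically_monotone_on_def
  proof (intro allI impI, rule ccontr)
    fix p :: "nat \<Rightarrow> 'a" and n
    assume p: "\<forall>i. p i \<in> N"
      and pos: "\<not> (\<Sum>i<n. T (p i) \<bullet> (p (Suc i) - p i)) + T (p n) \<bullet> (p 0 - p n) \<le> 0"
    define I where "I = {..n}"
    \<comment> \<open>The cyclic shift of \<open>{..n}\<close>; its wrap-around accounts for the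
      closing summand of the cycle.\<close>
    define \<sigma> where "\<sigma> i = (if i = n then 0 else Suc i)" for i
    have I: "finite I" "I \<noteq> {}" "card I = Suc n" by (auto simp: I_def)
    have \<sigma>: "bij_betw \<sigma> I I"
      unfolding bij_betw_def
    proof
      show "inj_on \<sigma> I" by (auto simp: inj_on_def \<sigma>_def I_def split: if_splits)
      then show "\<sigma> ` I = I"
        by (intro endo_inj_surj) (auto simp: I_def \<sigma>_def)
    qed
    have \<sigma>I: "i \<in> I \<Longrightarrow> \<sigma> i \<in> I" for i using \<sigma> by (auto simp: bij_betw_def)
    \<comment> \<open>Pairing \<open>y i\<close> with \<open>x (\<sigma> i)\<close> instead of
      \<open>x i\<close> lowers the sum of squared distances by exactly twice this quantity.\<close>
    define gap where "gap x y = (\<Sum>i\<in>I. y i \<bullet> (x (\<sigma> i) - x i))" for x y :: "nat \<Rightarrow> 'a"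
    have "gap p (\<lambda>i. T (p i)) = (\<Sum>i<n. T (p i) \<bullet> (p (Suc i) - p i)) + T (p n) \<bullet> (p 0 - p n)"
      unfolding gap_def I_def lessThan_Suc_atMost[symmetric] by (simp add: \<sigma>_def)
    with pos have gap_pos: "gap p (\<lambda>i. T (p i)) > 0" by simp
    define Q where "Q = PiM I (\<lambda>_. \<mu>)"
    interpret PQ: product_prob_space "\<lambda>_. \<mu>" I
      by unfold_locales
    interpret Q: prob_space Q
      unfolding Q_def by (rule prob_space_PiM) (rule \<mu>.prob_space_axioms)
    have c[measurable]: "(\<lambda>w. w i) \<in> borel_measurable Q" if "i \<in> I" for i
      using that measurable_component_singleton[of i I "\<lambda>_. \<mu>"] unfolding Q_def by simp
    have c\<sigma>[measurable]: "(\<lambda>w. w (\<sigma> i)) \<in> borel_measurable Q" if "i \<in> I" for i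
      using \<sigma>I[OF that] by (rule c)
    have gapm[measurable]: "(\<lambda>w. gap w (\<lambda>i. T (w i))) \<in> borel_measurable Q"
      unfolding gap_def by measurable
    define x' where "x' i w = (if gap w (\<lambda>i. T (w i)) > 0 then w (\<sigma> i) else w i)" for i and w :: "nat \<Rightarrow> 'a"
    have x'm[measurable]: "x' i \<in> borel_measurable Q" if [measurable]: "i \<in> I" for i
      unfolding x'_def by measurable
    have perm: "(\<Sum>i\<in>I. f (w (\<sigma> i))) = (\<Sum>i\<in>I. f (w i))" for f :: "'a \<Rightarrow> 'b::comm_monoid_add" and w
      by (rule sum.reindex_bij_betw[OF \<sigma>])
    have perm': "(\<Sum>i\<in>I. f (x' i w)) = (\<Sum>i\<in>I. f (w i))" for f :: "'a \<Rightarrow> 'b::comm_monoid_add" and w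
      by (cases "gap w (\<lambda>i. T (w i)) > 0") (simp_all add: x'_def perm)
    have comp: "(\<integral>\<^sup>+ w. (\<Sum>i\<in>I. f (w i)) / of_nat (card I) \<partial>Q) = (\<integral>\<^sup>+ x. f x \<partial>\<mu>)"
      if f[measurable]: "f \<in> borel_measurable borel" for f
    proof -
      have "(\<integral>\<^sup>+ w. (\<Sum>i\<in>I. f (w i)) / of_nat (card I) \<partial>Q) = (\<integral>\<^sup>+ w. (\<Sum>i\<in>I. f (w i)) \<partial>Q) / of_nat (card I)"
        by (rule nn_integral_divide) measurable
      also have "(\<integral>\<^sup>+ w. (\<Sum>i\<in>I. f (w i)) \<partial>Q) = (\<Sum>i\<in>I. \<integral>\<^sup>+ w. f (w i) \<partial>Q)"
        by (rule nn_integral_sum) measurable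
      also have "\<dots> = (\<Sum>i\<in>I. \<integral>\<^sup>+ x. f x \<partial>\<mu>)"
      proof (rule sum.cong[OF refl])
        fix i assume i: "i \<in> I"
        have "distr Q \<mu> (\<lambda>w. w i) = \<mu>"
          unfolding Q_def using PQ.PiM_component[OF i] .
        then have "(\<integral>\<^sup>+ x. f x \<partial>\<mu>) = (\<integral>\<^sup>+ x. f x \<partial>distr Q \<mu> (\<lambda>w. w i))" by simp
        also have "\<dots> = (\<integral>\<^sup>+ w. f (w i) \<partial>Q)"
          using c[OF i] f by (intro nn_integral_distr) (simp_all cong: measurable_cong_sets)
        finally show "(\<integral>\<^sup>+ w. f (w i) \<partial>Q) = (\<integral>\<^sup>+ x. f x \<partial>\<mu>)" ..
      qed
      also have "\<dots> / of_nat (card I) = (\<integral>\<^sup>+ x. f x \<partial>\<mu>)"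
        using I by (simp add: ennreal_mult_divide_eq mult.commute[of "of_nat _"] del: of_nat_Suc)
      finally show ?thesis .
    qed
    obtain P where P: "P \<in> prob_measures"
      "\<And>f. f \<in> borel_measurable borel \<Longrightarrow>
       (\<integral>\<^sup>+ z. f z \<partial>P) = (\<integral>\<^sup>+ w. (\<Sum>i\<in>I. f (x' i w, T (w i))) / of_nat (card I) \<partial>Q)"
    proof (rule nn_integral_average[OF I(1,2) Q.prob_space_axioms, of "\<lambda>i w. (x' i w, T (w i))"])
      fix i assume [measurable]: "i \<in> I"
      show "(\<lambda>w. (x' i w, T (w i))) \<in> borel_measurable Q" by measurable
    qed blast
    have [simp, measurable_cong]: "sets P = sets borel" using P(1) by (rule prob_measuresD)
    have "P \<in> couplings \<mu> \<nu>"
      unfolding couplings_def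
    proof (safe intro!: P(1))
      show "distr P borel fst = \<mu>"
      proof (rule measure_eqI)
        fix A :: "'a set" assume "A \<in> sets (distr P borel fst)"
        then have A[measurable]: "A \<in> sets borel" by simp
        have "emeasure (distr P borel fst) A = (\<integral>\<^sup>+ z. indicator A (fst z) \<partial>P)"
          by (rule emeasure_distr_nn_integral) measurable
        also have "\<dots> = (\<integral>\<^sup>+ w. (\<Sum>i\<in>I. indicator A (x' i w)) / of_nat (card I) \<partial>Q)"
          by (subst P(2)) simp_all
        also have "\<dots> = emeasure \<mu> A"
          by (simp add: perm' comp)
        finally show "emeasure (distr P borel fst) A = emeasure \<mu> A" .
      qed simp
      show "distr P borel snd = \<nu>"
        unfolding d\<nu>[symmetric]
      proof (rule measure_eqI)
        fix A :: "'a set" assume "A \<in> sets (distr P borel snd)"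
        then have A[measurable]: "A \<in> sets borel" by simp
        have "emeasure (distr P borel snd) A = (\<integral>\<^sup>+ z. indicator A (snd z) \<partial>P)"
          by (rule emeasure_distr_nn_integral) measurable
        also have "\<dots> = (\<integral>\<^sup>+ w. (\<Sum>i\<in>I. indicator A (T (w i))) / of_nat (card I) \<partial>Q)"
          by (subst P(2)) simp_all
        also have "\<dots> = (\<integral>\<^sup>+ x. indicator A (T x) \<partial>\<mu>)"
          by (rule comp) measurable
        also have "\<dots> = emeasure (distr \<mu> borel T) A"
          by (rule emeasure_distr_nn_integral[OF Tm' A, symmetric])
        finally show "emeasure (distr P borel snd) A = emeasure (distr \<mu> borel T) A" .
      qed simp
    qed
    then have "W2sq \<mu> \<nu> \<le> (\<integral>\<^sup>+ (x, y). ennreal ((norm (x - y))\<^sup>2) \<partial>P)"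
      unfolding W2sq_def by (rule INF_lower)
    also have "\<dots> = (\<integral>\<^sup>+ w. (\<Sum>i\<in>I. ennreal ((norm (x' i w - T (w i)))\<^sup>2)) / of_nat (card I) \<partial>Q)"
      by (subst P(2)) simp_all
    finally have le: "W2sq \<mu> \<nu> \<le> (\<integral>\<^sup>+ w. (\<Sum>i\<in>I. ennreal ((norm (x' i w - T (w i)))\<^sup>2)) / of_nat (card I) \<partial>Q)"
      (is "_ \<le> ?R") .
    \<comment> \<open>The optimal cost is split into the cost of the competitor and the expected
      saving. Since the former is already at least the finite optimal cost, the saving must vanish
      almost everywhere.\<close>
    have "W2sq \<mu> \<nu> = (\<integral>\<^sup>+ w. (\<Sum>i\<in>I. ennreal ((norm (T (w i) - w i))\<^sup>2)) / of_nat (card I) \<partial>Q)"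
      unfolding cost by (rule comp[symmetric]) measurable
    also have "\<dots> = (\<integral>\<^sup>+ w. (\<Sum>i\<in>I. ennreal ((norm (x' i w - T (w i)))\<^sup>2)) / of_nat (card I)
        + ennreal (2 * max 0 (gap w (\<lambda>i. T (w i)))) / of_nat (card I) \<partial>Q)"
    proof (rule nn_integral_cong)
      fix w
      have e: "(norm (x - y))\<^sup>2 = (norm x)\<^sup>2 + ((norm y)\<^sup>2 - 2 * (y \<bullet> x))" for x y :: 'a
        by (simp add: power2_norm_eq_inner inner_diff inner_commute)
      have s: "(\<Sum>i\<in>I. (norm (z i - T (w i)))\<^sup>2) = (\<Sum>i\<in>I. (norm (z i))\<^sup>2) + (\<Sum>i\<in>I. (norm (T (w i)))\<^sup>2)
          - 2 * (\<Sum>i\<in>I. T (w i) \<bullet> z i)" for z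
        unfolding e by (simp add: sum.distrib sum_subtractf sum_distrib_left)
      have g: "gap w (\<lambda>i. T (w i)) = (\<Sum>i\<in>I. T (w i) \<bullet> w (\<sigma> i)) - (\<Sum>i\<in>I. T (w i) \<bullet> w i)"
        unfolding gap_def by (simp add: inner_diff_right sum_subtractf)
      have "(\<Sum>i\<in>I. (norm (T (w i) - w i))\<^sup>2) =
          (\<Sum>i\<in>I. (norm (x' i w - T (w i)))\<^sup>2) + 2 * max 0 (gap w (\<lambda>i. T (w i)))"
      proof -
        have "(\<Sum>i\<in>I. (norm (x' i w))\<^sup>2) = (\<Sum>i\<in>I. (norm (w i))\<^sup>2)" by (rule perm')
        moreover have "(\<Sum>i\<in>I. T (w i) \<bullet> x' i w) = (\<Sum>i\<in>I. T (w i) \<bullet> w i) + max 0 (gap w (\<lambda>i. T (w i)))"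
          by (cases "gap w (\<lambda>i. T (w i)) > 0") (simp_all add: x'_def g)
        ultimately show ?thesis
          unfolding norm_minus_commute[of "T (w _)"] s by simp
      qed
      then show "(\<Sum>i\<in>I. ennreal ((norm (T (w i) - w i))\<^sup>2)) / of_nat (card I) =
         (\<Sum>i\<in>I. ennreal ((norm (x' i w - T (w i)))\<^sup>2)) / of_nat (card I)
          + ennreal (2 * max 0 (gap w (\<lambda>i. T (w i)))) / of_nat (card I)"
        by (simp add: sum_ennreal sum_nonneg add_divide_distrib_ennreal[symmetric] flip: ennreal_plus)
    qed
    also have "\<dots> = ?R + (\<integral>\<^sup>+ w. ennreal (2 * max 0 (gap w (\<lambda>i. T (w i)))) / of_nat (card I) \<partial>Q)"
      by (rule nn_integral_add) measurable
    finally have eq: "W2sq \<mu> \<nu> = ?R + (\<integral>\<^sup>+ w. ennreal (2 * max 0 (gap w (\<lambda>i. T (w i)))) / of_nat (card I) \<partial>Q)" .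
    then have "(\<integral>\<^sup>+ w. ennreal (2 * max 0 (gap w (\<lambda>i. T (w i)))) / of_nat (card I) \<partial>Q) = 0"
      using le fin by (cases "?R"; cases "\<integral>\<^sup>+ w. ennreal (2 * max 0 (gap w (\<lambda>i. T (w i)))) / of_nat (card I) \<partial>Q") (auto simp flip: ennreal_plus)
    then have "AE w in Q. ennreal (2 * max 0 (gap w (\<lambda>i. T (w i)))) / of_nat (card I) = 0"
      by (subst (asm) nn_integral_0_iff_AE) measurable
    then have AE0: "AE w in Q. \<not> gap w (\<lambda>i. T (w i)) > 0"
      by eventually_elim (auto simp: ennreal_divide_eq_0_iff)
    \<comment> \<open>Positivity of the gap is an open condition in the product topology, so it
      persists on a box around the violating cycle. Pulled back along the graph, the factors of the
      box have positive measure, so the product measure sees a positive gap.\<close>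
    define U where "U = {q :: nat \<Rightarrow> 'a \<times> 'a. gap (\<lambda>i. fst (q i)) (\<lambda>i. snd (q i)) > 0}"
    have "open U"
      unfolding U_def gap_def
      by (intro open_Collect_less continuous_intros continuous_on_fst continuous_on_snd continuous_on_product_coordinates)
    moreover have "(\<lambda>i. (p i, T (p i))) \<in> U" using gap_pos by (simp add: U_def)
    ultimately obtain X where X: "(\<lambda>i. (p i, T (p i))) \<in> (\<Pi>\<^sub>E i\<in>UNIV. X i)" "\<And>i. open (X i)" "(\<Pi>\<^sub>E i\<in>UNIV. X i) \<subseteq> U"
      using product_topology_open_contains_basis[of "\<lambda>_. euclidean" UNIV U "\<lambda>i. (p i, T (p i))"]
      by (auto simp: open_fun_def)
    define Y where "Y i = {x. (x, T x) \<in> X i}" for i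
    have Ym[measurable]: "Y i \<in> sets borel" for i
    proof -
      have [measurable]: "X i \<in> sets borel" using X(2) by simp
      have "Y i = (\<lambda>x. (x, T x)) -` X i \<inter> space borel" by (auto simp: Y_def)
      also have "\<dots> \<in> sets borel" by (rule measurable_sets[where A = borel]) measurable
      finally show ?thesis .
    qed
    have Ypos: "emeasure \<mu> (Y i) > 0" for i
    proof -
      have "emeasure \<Gamma> (X i) > 0"
        using p X(1,2) unfolding N_def measure_support_def by (auto simp: PiE_iff)
      also have "emeasure \<Gamma> (X i) = emeasure \<mu> (Y i)"
        unfolding \<Gamma>_def Y_def using X(2) by (subst emeasure_distr[OF graph_m]) (auto simp: vimage_def)
      finally show ?thesis .
    qed
    have "emeasure Q (PiE I Y) = (\<Prod>i\<in>I. emeasure \<mu> (Y i))"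
      unfolding Q_def by (rule PQ.emeasure_PiM) (use I in auto)
    also have "\<dots> \<noteq> 0"
      using Ypos I by (auto simp: prod_zero_iff less_le)
    finally have nz: "emeasure Q (PiE I Y) \<noteq> 0" .
    have "AE w in Q. w \<notin> PiE I Y"
      using AE0
    proof eventually_elim
      fix w assume w: "\<not> gap w (\<lambda>i. T (w i)) > 0"
      show "w \<notin> PiE I Y"
      proof
        assume wY: "w \<in> PiE I Y"
        \<comment> \<open>A point \<open>w\<close> of the finite product carries no information
          outside \<open>I\<close>; the missing coordinates are filled from \<open>p\<close>, and
          the gap does not see them.\<close>
        have "(\<lambda>i. if i \<in> I then (w i, T (w i)) else (p i, T (p i))) \<in> U" (is "?q \<in> U")
          using X(1) wY by (intro subsetD[OF X(3)]) (auto simp: Y_def PiE_iff)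
        moreover have "gap (\<lambda>i. fst (?q i)) (\<lambda>i. snd (?q i)) = gap w (\<lambda>i. T (w i))"
          unfolding gap_def using \<sigma>I by (intro sum.cong) auto
        ultimately show False using w by (simp add: U_def)
      qed
    qed
    moreover have "PiE I Y \<in> sets Q"
      unfolding Q_def by (rule sets_PiM_I_finite) (use I in auto)
    ultimately have "emeasure Q (PiE I Y) = 0"
      using AE_iff_measurable[of "PiE I Y" Q "\<lambda>w. w \<notin> PiE I Y"] sets.sets_into_space[of "PiE I Y" Q] by auto
    with nz show False by simp
  qed
  ultimately show ?thesis by blast
qed

section \<open>Convex potentials\<close>

text \<open>A convex set has the same interior as its closure, so an open set in the closure of the
  hull lies in the hull itself. This carries finiteness of a potential from a dense set to all of
  \<open>\<Omega>\<close>.\<close>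

lemma subset_convex_hull_dense:
  fixes N :: "'a::euclidean_space set"
  assumes "open \<Omega>" "\<Omega> \<subseteq> closure N"
  shows "\<Omega> \<subseteq> convex hull N"
proof -
  have "\<Omega> \<subseteq> interior (closure (convex hull N))"
    using assms by (meson closure_mono hull_subset interior_maximal order_trans)
  also have "\<dots> = interior (convex hull N)"
    by (rule convex_interior_closure) simp
  also have "\<dots> \<subseteq> convex hull N" by (rule interior_subset)
  finally show ?thesis .
qed

text \<open>
  Rockafellar's construction.  The disjunction makes the supremum finite on the whole space; the last
  property records that all slopes of the potential lie in \<open>T ` N\<close>.
\<close>

lemma cyclically_monotone_potential:
  fixes N :: "'a::euclidean_space set"
  assumes cm: "cyclically_monotone_on N T" and ne: "N \<noteq> {}"
    and hull: "convex hull N = UNIV \<or> bounded (T ` N)"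
  obtains \<phi> where "convex_on UNIV \<phi>"
    "\<And>x z. x \<in> N \<Longrightarrow> \<phi> x + T x \<bullet> (z - x) \<le> \<phi> z"
    "\<And>w z b. (\<And>x. x \<in> N \<Longrightarrow> T x \<bullet> (z - w) \<le> b) \<Longrightarrow> \<phi> z \<le> \<phi> w + b"
proof -
  obtain x0 where x0: "x0 \<in> N" using ne by blast
  \<comment> \<open>\<open>S\<close> holds the chains in \<open>N\<close> that start at
    \<open>x0\<close>, cut off at index \<open>n\<close>; \<open>h\<close> is the affine function
    obtained by following the slopes along a chain, its own slope being \<open>T\<close> at the last
    point.\<close>
  define S where "S = {(p :: nat \<Rightarrow> 'a, n :: nat). p 0 = x0 \<and> (\<forall>i. p i \<in> N)}"
  define h where "h q z = (case q of (p, n) \<Rightarrow>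
      (\<Sum>i<n. T (p i) \<bullet> (p (Suc i) - p i)) + T (p n) \<bullet> (z - p n))" for q :: "(nat \<Rightarrow> 'a) \<times> nat" and z
  have S_ne: "S \<noteq> {}" using x0 by (auto simp: S_def intro!: exI[of _ "\<lambda>_. x0"])
  have shift: "h q z = h q w + T (fst q (snd q)) \<bullet> (z - w)" for q z w
    by (simp add: h_def case_prod_beta inner_diff_right)
  have in_N: "fst q (snd q) \<in> N" if "q \<in> S" for q using that by (auto simp: S_def)
  have extend: "\<exists>r\<in>S. \<forall>z. h r z = h q x + T x \<bullet> (z - x)" if q: "q \<in> S" and x: "x \<in> N" for q x
  proof -
    obtain p n where pn: "q = (p, n)" by (cases q)
    let ?r = "(p(Suc n := x), Suc n)"
    have "(\<Sum>i<n. T ((p(Suc n := x)) i) \<bullet> ((p(Suc n := x)) (Suc i) - (p(Suc n := x)) i))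
        = (\<Sum>i<n. T (p i) \<bullet> (p (Suc i) - p i))"
      by (rule sum.cong) auto
    then have "h ?r z = h q x + T x \<bullet> (z - x)" for z
      by (simp add: h_def pn)
    moreover have "?r \<in> S" using q x by (auto simp: S_def pn)
    ultimately show ?thesis by blast
  qed
  \<comment> \<open>Returning to \<open>x0\<close> closes the chain to a cycle.\<close>
  have h0: "h q x0 \<le> 0" if "q \<in> S" for q
    using that cm by (auto simp: S_def h_def cyclically_monotone_on_def)
  have hN: "h q x \<le> T x \<bullet> (x - x0)" if q: "q \<in> S" and x: "x \<in> N" for q x
  proof -
    obtain r where "r \<in> S" "h r x0 = h q x + T x \<bullet> (x0 - x)" using extend[OF q x] by blast
    with h0[of r] show ?thesis by (simp add: inner_diff_right)
  qed
  \<comment> \<open>The functions \<open>h q\<close> are affine, so the points where their supremum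
    is finite form a convex set. It contains \<open>N\<close>, hence the convex hull of
    \<open>N\<close>. In the other alternative the slopes are bounded and \<open>h q x0\<close> is
    at most 0, which bounds the supremum at every point.\<close>
  define B where "B = {z. bdd_above ((\<lambda>q. h q z) ` S)}"
  have "convex B"
  proof (rule convexI)
    fix x y :: 'a and u v :: real
    assume "x \<in> B" "y \<in> B" and uv: "0 \<le> u" "0 \<le> v" "u + v = 1"
    then obtain bx "by" where b: "\<And>q. q \<in> S \<Longrightarrow> h q x \<le> bx" "\<And>q. q \<in> S \<Longrightarrow> h q y \<le> by"
      by (auto simp: B_def bdd_above_def)
    have "h q (u *\<^sub>R x + v *\<^sub>R y) \<le> u * bx + v * by" if "q \<in> S" for q
    proof -
      have "h q (u *\<^sub>R x + v *\<^sub>R y) = (u + v) * h q 0 + T (fst q (snd q)) \<bullet> (u *\<^sub>R x + v *\<^sub>R y)"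
        using shift[of q "u *\<^sub>R x + v *\<^sub>R y" 0] uv by simp
      also have "\<dots> = u * h q x + v * h q y"
        using shift[of q x 0] shift[of q y 0] by (simp add: inner_simps algebra_simps)
      also have "\<dots> \<le> u * bx + v * by"
        using b that uv by (intro add_mono mult_left_mono) auto
      finally show ?thesis .
    qed
    then show "u *\<^sub>R x + v *\<^sub>R y \<in> B"
      unfolding B_def mem_Collect_eq by (rule bdd_aboveI2)
  qed
  have "N \<subseteq> B"
  proof
    fix x assume x: "x \<in> N"
    show "x \<in> B" unfolding B_def mem_Collect_eq by (rule bdd_aboveI2) (rule hN[OF _ x])
  qed
  have bdd: "bdd_above ((\<lambda>q. h q z) ` S)" for z
    using hull
  proof
    assume "convex hull N = UNIV"
    moreover have "convex hull N \<subseteq> B" using \<open>N \<subseteq> B\<close> \<open>convex B\<close> by (rule hull_minimal)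
    ultimately show ?thesis by (auto simp: B_def)
  next
    assume "bounded (T ` N)"
    then obtain b where b: "\<And>x. x \<in> N \<Longrightarrow> norm (T x) \<le> b" by (auto simp: bounded_iff)
    have "h q z \<le> b * norm (z - x0)" if "q \<in> S" for q
    proof -
      have "h q z \<le> T (fst q (snd q)) \<bullet> (z - x0)" using shift[of q z x0] h0[OF that] by simp
      also have "\<dots> \<le> norm (T (fst q (snd q))) * norm (z - x0)" by (rule norm_cauchy_schwarz)
      also have "\<dots> \<le> b * norm (z - x0)" by (intro mult_right_mono b in_N that) auto
      finally show ?thesis .
    qed
    then show ?thesis by (rule bdd_aboveI2)
  qed
  define \<phi> where "\<phi> z = (SUP q\<in>S. h q z)" for z
  have upper: "h q z \<le> \<phi> z" if "q \<in> S" for q z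
    unfolding \<phi>_def using that bdd by (rule cSUP_upper)
  have least: "\<phi> z \<le> b" if "\<And>q. q \<in> S \<Longrightarrow> h q z \<le> b" for z b
    unfolding \<phi>_def using that S_ne by (intro cSUP_least) auto
  show thesis
  proof (rule that)
    show "convex_on UNIV \<phi>"
    proof (rule convex_onI)
      fix t :: real and x y :: 'a assume t: "0 < t" "t < 1"
      show "\<phi> ((1 - t) *\<^sub>R x + t *\<^sub>R y) \<le> (1 - t) * \<phi> x + t * \<phi> y"
      proof (rule least)
        fix q assume q: "q \<in> S"
        have "h q ((1 - t) *\<^sub>R x + t *\<^sub>R y) = (1 - t) * h q x + t * h q y"
          using shift[of q x 0] shift[of q y 0] shift[of q "(1 - t) *\<^sub>R x + t *\<^sub>R y" 0]
            by (simp add: inner_simps algebra_simps)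
        also have "\<dots> \<le> (1 - t) * \<phi> x + t * \<phi> y"
          using t upper[OF q] by (intro add_mono mult_left_mono) auto
        finally show "h q ((1 - t) *\<^sub>R x + t *\<^sub>R y) \<le> (1 - t) * \<phi> x + t * \<phi> y" .
      qed
    qed simp
  next
    fix x z assume x: "x \<in> N"
    have "\<phi> x \<le> \<phi> z - T x \<bullet> (z - x)"
    proof (rule least)
      fix q assume "q \<in> S"
      then obtain r where "r \<in> S" "h r z = h q x + T x \<bullet> (z - x)" using extend[OF _ x] by blast
      with upper[of r z] show "h q x \<le> \<phi> z - T x \<bullet> (z - x)" by simp
    qed
    then show "\<phi> x + T x \<bullet> (z - x) \<le> \<phi> z" by simp
  next
    fix w z b assume b: "\<And>x. x \<in> N \<Longrightarrow> T x \<bullet> (z - w) \<le> b"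
    show "\<phi> z \<le> \<phi> w + b"
    proof (rule least)
      fix q assume q: "q \<in> S"
      show "h q z \<le> \<phi> w + b"
        using shift[of q z w] upper[OF q, of w] b[OF in_N[OF q]] by simp
    qed
  qed
qed

lemma conjugate_potential:
  fixes N :: "'a::euclidean_space set"
  assumes sub: "\<And>x z. x \<in> N \<Longrightarrow> \<phi> x + T x \<bullet> (z - x) \<le> \<phi> z"
    and \<Omega>: "\<Omega> \<subseteq> convex hull (T ` N)" "convex \<Omega>"
  obtains \<psi> where "convex_on \<Omega> \<psi>"
    "\<And>y z. y \<in> \<Omega> \<Longrightarrow> y \<bullet> z \<le> \<phi> z + \<psi> y"
    "\<And>x. x \<in> N \<Longrightarrow> \<psi> (T x) = T x \<bullet> x - \<phi> x"
proof -
  define B where "B = {y. bdd_above (range (\<lambda>z. y \<bullet> z - \<phi> z))}"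
  have TB: "T x \<bullet> z - \<phi> z \<le> T x \<bullet> x - \<phi> x" if "x \<in> N" for x z
    using sub[OF that, of z] by (simp add: inner_diff_right)
  have "convex B"
  proof (rule convexI)
    fix x y :: 'a and u v :: real
    assume "x \<in> B" "y \<in> B" and uv: "0 \<le> u" "0 \<le> v" "u + v = 1"
    then obtain bx "by" where b: "\<And>z. x \<bullet> z - \<phi> z \<le> bx" "\<And>z. y \<bullet> z - \<phi> z \<le> by"
      by (auto simp: B_def bdd_above_def)
    have "(u *\<^sub>R x + v *\<^sub>R y) \<bullet> z - \<phi> z \<le> u * bx + v * by" for z
    proof -
      have "(u *\<^sub>R x + v *\<^sub>R y) \<bullet> z - (u + v) * \<phi> z = u * (x \<bullet> z - \<phi> z) + v * (y \<bullet> z - \<phi> z)"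
        by (simp add: inner_simps algebra_simps)
      also have "\<dots> \<le> u * bx + v * by"
        using b uv by (intro add_mono mult_left_mono) auto
      finally show ?thesis using uv by simp
    qed
    then show "u *\<^sub>R x + v *\<^sub>R y \<in> B"
      unfolding B_def mem_Collect_eq by (rule bdd_aboveI2)
  qed
  moreover have "T ` N \<subseteq> B" using TB by (fastforce simp: B_def bdd_above_def)
  ultimately have \<Omega>B: "\<Omega> \<subseteq> B" using \<Omega>(1) hull_minimal[of "T ` N" B convex] by blast
  define \<psi> where "\<psi> y = (SUP z. y \<bullet> z - \<phi> z)" for y
  have upper: "y \<bullet> z - \<phi> z \<le> \<psi> y" if "y \<in> B" for y z
    unfolding \<psi>_def using that by (intro cSUP_upper) (auto simp: B_def)
  have least: "\<psi> y \<le> b" if "\<And>z. y \<bullet> z - \<phi> z \<le> b" for y b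
    unfolding \<psi>_def using that by (intro cSUP_least) auto
  show thesis
  proof (rule that)
    show "convex_on \<Omega> \<psi>"
    proof (rule convex_onI[OF _ \<Omega>(2)])
      fix t :: real and x y :: 'a assume t: "0 < t" "t < 1" and xy: "x \<in> \<Omega>" "y \<in> \<Omega>"
      show "\<psi> ((1 - t) *\<^sub>R x + t *\<^sub>R y) \<le> (1 - t) * \<psi> x + t * \<psi> y"
      proof (rule least)
        fix z
        have "((1 - t) *\<^sub>R x + t *\<^sub>R y) \<bullet> z - \<phi> z = (1 - t) * (x \<bullet> z - \<phi> z) + t * (y \<bullet> z - \<phi> z)"
          by (simp add: inner_simps algebra_simps)
        also have "\<dots> \<le> (1 - t) * \<psi> x + t * \<psi> y"
          using t xy \<Omega>B upper by (intro add_mono mult_left_mono) auto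
        finally show "((1 - t) *\<^sub>R x + t *\<^sub>R y) \<bullet> z - \<phi> z \<le> (1 - t) * \<psi> x + t * \<psi> y" .
      qed
    qed
    show "y \<bullet> z \<le> \<phi> z + \<psi> y" if "y \<in> \<Omega>" for y z
      using upper[of y z] that \<Omega>B by auto
    show "\<psi> (T x) = T x \<bullet> x - \<phi> x" if "x \<in> N" for x
      using upper[of "T x" x] least[of "T x"] TB[OF that] \<open>T ` N \<subseteq> B\<close> that by (intro antisym) auto
  qed
qed

text \<open>The average of the subgradients \<open>T j x\<close> is a subgradient of the averaged
  potential, and it equals \<open>x\<close>, the gradient of half the squared norm. This ties the
  averaged potential to that function up to a constant.\<close>

lemma average_potential:
  fixes \<phi> :: "'m::finite \<Rightarrow> 'a::euclidean_space \<Rightarrow> real" and l :: "'m \<Rightarrow> real"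
  assumes l: "\<And>j. 0 \<le> l j" "(\<Sum>j\<in>UNIV. l j) = 1"
    and cvx: "\<And>j. convex_on UNIV (\<phi> j)"
    and sub: "\<And>j x z. x \<in> N \<Longrightarrow> \<phi> j x + T j x \<bullet> (z - x) \<le> \<phi> j z"
    and slope: "\<And>j w z b. (\<And>x. x \<in> N \<Longrightarrow> T j x \<bullet> (z - w) \<le> b) \<Longrightarrow> \<phi> j z \<le> \<phi> j w + b"
    and avg: "\<And>x. x \<in> N \<Longrightarrow> (\<Sum>j\<in>UNIV. l j *\<^sub>R T j x) = x"
    and \<Omega>: "convex \<Omega>" "\<Omega> \<noteq> {}" "\<Omega> \<subseteq> closure N"
    and range: "\<Omega> = UNIV \<or> (\<forall>j. \<forall>x\<in>N. T j x \<in> \<Omega>)"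
  obtains C where "\<And>x. x \<in> \<Omega> \<Longrightarrow> (\<Sum>j\<in>UNIV. l j * \<phi> j x) = (norm x)\<^sup>2 / 2 + C"
    "\<And>z. (\<Sum>j\<in>UNIV. l j * \<phi> j z) \<le> (norm z)\<^sup>2 / 2 + C"
proof -
  define F where "F z = (\<Sum>j\<in>UNIV. l j * \<phi> j z)" for z
  define G where "G z = F z - (norm z)\<^sup>2 / 2" for z
  have "continuous_on UNIV (\<phi> j)" for j
    using cvx by (intro convex_on_continuous) auto
  then have contG: "continuous_on UNIV G"
    unfolding G_def F_def by (intro continuous_intros) auto
  have GN: "G x - (norm (z - x))\<^sup>2 / 2 \<le> G z" if x: "x \<in> N" for x z
  proof -
    have "F x + x \<bullet> (z - x) = (\<Sum>j\<in>UNIV. l j * (\<phi> j x + T j x \<bullet> (z - x)))"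
      unfolding F_def
      by (subst (2) avg[OF x, symmetric]) (simp add: inner_sum_left distrib_left sum.distrib)
    also have "\<dots> \<le> F z"
      unfolding F_def using l sub[OF x] by (intro sum_mono mult_left_mono) auto
    finally show ?thesis
      by (simp add: G_def power2_norm_eq_inner inner_diff inner_commute[of z x] field_simps)
  qed
  have G\<Omega>: "G x - (norm (z - x))\<^sup>2 / 2 \<le> G z" if "x \<in> closure N" for x z
  proof (rule continuous_le_on_closure[OF _ that])
    show "continuous_on (closure N) (\<lambda>x. G x - (norm (z - x))\<^sup>2 / 2)"
      by (intro continuous_intros continuous_on_subset[OF contG]) auto
  qed (rule GN)
  have "\<exists>C. \<forall>x\<in>\<Omega>. G x = C"
  \<comment> \<open>Both points lie in the closure of \<open>N\<close>, so the one-sided bound may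
    be used in either direction; the increments of \<open>G\<close> are quadratic in the distance
    and its derivative vanishes.\<close>
  proof (rule has_derivative_zero_constant[OF \<Omega>(1)])
    fix x assume x: "x \<in> \<Omega>"
    show "(G has_derivative (\<lambda>h. 0)) (at x within \<Omega>)"
      unfolding has_derivative_within_alt
    proof (safe intro!: bounded_linear_zero)
      fix e :: real assume "e > 0"
      show "\<exists>d>0. \<forall>y\<in>\<Omega>. norm (y - x) < d \<longrightarrow> norm (G y - G x - 0) \<le> e * norm (y - x)"
      proof (intro exI[of _ e] conjI ballI impI)
        fix y assume y: "y \<in> \<Omega>" "norm (y - x) < e"
        have "\<bar>G y - G x\<bar> \<le> (norm (y - x))\<^sup>2 / 2"
          using G\<Omega>[of x y] G\<Omega>[of y x] subsetD[OF \<Omega>(3) x] subsetD[OF \<Omega>(3) y(1)]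
          unfolding abs_le_iff norm_minus_commute[of x y] by linarith
        also have "\<dots> \<le> norm (y - x) * norm (y - x)"
          by (simp add: power2_eq_square)
        also have "\<dots> \<le> e * norm (y - x)" using y by (intro mult_right_mono) auto
        finally show "norm (G y - G x - 0) \<le> e * norm (y - x)" by simp
      qed fact
    qed
  qed
  then obtain C where C: "\<And>x. x \<in> \<Omega> \<Longrightarrow> G x = C" by blast
  have Ccl: "G x = C" if "x \<in> closure \<Omega>" for x
    by (rule continuous_constant_on_closure[OF continuous_on_subset[OF contG] C that]) auto
  show thesis
  proof (rule that)
    show "(\<Sum>j\<in>UNIV. l j * \<phi> j x) = (norm x)\<^sup>2 / 2 + C" if "x \<in> \<Omega>" for x
      using C[OF that] by (simp add: G_def F_def)
    show "(\<Sum>j\<in>UNIV. l j * \<phi> j z) \<le> (norm z)\<^sup>2 / 2 + C" for z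
      using range
    proof
      assume "\<Omega> = UNIV"
      then show ?thesis using C[of z] by (simp add: G_def F_def)
    next
      assume T: "\<forall>j. \<forall>x\<in>N. T j x \<in> \<Omega>"
      \<comment> \<open>For \<open>y\<close> in the closure of \<open>\<Omega>\<close>, the inner
        product of \<open>y\<close> with \<open>z - w\<close> is largest at the projection
        \<open>w\<close> itself. All slopes lie in that closure, so \<open>\<phi> j\<close> grows
        from \<open>w\<close> to \<open>z\<close> by at most \<open>w \<bullet> (z - w)\<close>, the
        same bound for every \<open>j\<close>.\<close>
      define w where "w = closest_point (closure \<Omega>) z"
      have w: "w \<in> closure \<Omega>" unfolding w_def using \<Omega>(2) by (intro closest_point_in_set) auto
      have "\<phi> j z \<le> \<phi> j w + w \<bullet> (z - w)" for j
      proof (rule slope)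
        fix x assume "x \<in> N"
        then have "T j x \<in> closure \<Omega>" using T closure_subset by blast
        then have "(z - w) \<bullet> (T j x - w) \<le> 0"
          unfolding w_def using \<Omega>(1) by (intro closest_point_dot) (auto intro: convex_closure)
        then show "T j x \<bullet> (z - w) \<le> w \<bullet> (z - w)"
          by (simp add: inner_diff_right inner_diff_left inner_commute)
      qed
      then have "F z \<le> (\<Sum>j\<in>UNIV. l j * (\<phi> j w + w \<bullet> (z - w)))"
        unfolding F_def using l by (intro sum_mono mult_left_mono) auto
      also have "\<dots> = F w + w \<bullet> (z - w)"
        using l(2) by (simp add: F_def distrib_left sum.distrib sum_distrib_right[symmetric])
      also have "F w = (norm w)\<^sup>2 / 2 + C" using Ccl[OF w] by (simp add: G_def)
      also have "(norm w)\<^sup>2 / 2 + C + w \<bullet> (z - w) = (norm z)\<^sup>2 / 2 + C - (norm (z - w))\<^sup>2 / 2"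
          by (simp add: power2_norm_eq_inner inner_diff inner_commute[of z w] field_simps)
      also have "\<dots> \<le> (norm z)\<^sup>2 / 2 + C" by simp
      finally show ?thesis by (simp add: F_def)
    qed
  qed
qed

section \<open>Second differences of convex functions\<close>

lemma lborel_integral_translate:
  fixes f :: "'a::euclidean_space \<Rightarrow> real"
  assumes [measurable]: "f \<in> borel_measurable borel"
  shows "(\<integral>x. f (x + c) \<partial>lborel) = (\<integral>x. f x \<partial>lborel)"
    and "integrable lborel f \<Longrightarrow> integrable lborel (\<lambda>x. f (x + c))"
proof -
  have d: "distr lborel borel ((+) c) = (lborel :: 'a measure)"
    by (rule lborel_distr_plus)
  have "(\<integral>x. f x \<partial>lborel) = (\<integral>x. f x \<partial>distr lborel borel ((+) c))"
    by (simp add: d)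
  also have "\<dots> = (\<integral>x. f (c + x) \<partial>lborel)"
    by (rule integral_distr) auto
  finally show "(\<integral>x. f (x + c) \<partial>lborel) = (\<integral>x. f x \<partial>lborel)" by (simp add: add.commute)
  show "integrable lborel (\<lambda>x. f (x + c))" if "integrable lborel f"
  proof -
    have "integrable (distr lborel borel ((+) c)) f" using that by (simp add: d)
    then have "integrable lborel (\<lambda>x. f (c + x))"
      by (subst (asm) integrable_distr_eq) auto
    then show ?thesis by (simp add: add.commute)
  qed
qed

text \<open>
  The second difference is integrated against a Lipschitz cutoff \<open>\<eta>\<close>; summation by parts turns it into
  first differences of \<open>\<eta>\<close> (of order \<open>t\<close>) times first differences of \<open>\<psi>\<close> (uniformly small).
\<close>

lemma second_difference_tendsto_0:
  fixes \<psi> :: "'a::euclidean_space \<Rightarrow> real"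
  assumes \<Omega>: "open \<Omega>" and K: "compact K" "K \<subseteq> \<Omega>"
    and cvx: "convex_on \<Omega> \<psi>" and cont: "continuous_on \<Omega> \<psi>"
    and e: "norm e = 1" and \<epsilon>: "0 < \<epsilon>"
  obtains t0 where "t0 > 0"
    "\<And>t y. 0 < t \<Longrightarrow> t < t0 \<Longrightarrow> y \<in> K \<Longrightarrow> y + t *\<^sub>R e \<in> \<Omega> \<and> y - t *\<^sub>R e \<in> \<Omega>"
    "\<And>t. 0 < t \<Longrightarrow> t < t0 \<Longrightarrow>
       (\<integral>\<^sup>+ y. indicator K y * ennreal ((\<psi> (y + t *\<^sub>R e) + \<psi> (y - t *\<^sub>R e) - 2 * \<psi> y) / t) \<partial>lborel) \<le> ennreal \<epsilon>"
proof (cases "K = {}")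
  case True
  then show thesis by (intro that[of 1]) auto
next
  case ne: False
  obtain r where r: "r > 0" "(\<Union>x\<in>K. cball x r) \<subseteq> \<Omega>"
    using compact_subset_open_imp_cball_epsilon_subset[OF K(1) \<Omega> K(2)] by blast
  define Kr where "Kr = {x. infdist x K \<le> r}"
  have Kr: "compact Kr" unfolding Kr_def using ne K(1) r(1) by (rule compact_infdist_le)
  have Kr\<Omega>: "Kr \<subseteq> \<Omega>"
  proof
    fix x assume "x \<in> Kr"
    moreover obtain a where "a \<in> K" "infdist x K = dist x a"
      using infdist_attains_inf[of K x] K(1) ne compact_imp_closed by blast
    ultimately show "x \<in> \<Omega>" using r(2) dist_commute[of x a] by (auto simp: Kr_def subset_iff)
  qed
  have [measurable]: "Kr \<in> sets borel" "K \<in> sets borel" using Kr K(1) by (auto intro: borel_compact)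
  define vol where "vol = measure lborel Kr"
  have emKr: "emeasure lborel Kr < \<infinity>" using Kr emeasure_compact_finite by blast
  \<comment> \<open>The modulus allowed for first differences:
    \<open>vol * (2 / r * t * \<omega>)\<close> comes out as at most \<open>t * \<epsilon>\<close>.
    The summand 1 keeps the denominator positive.\<close>
  define \<omega> where "\<omega> = \<epsilon> * r / (2 * (vol + 1))"
  have vol: "vol \<ge> 0" by (simp add: vol_def)
  then have \<omega>: "\<omega> > 0" using \<epsilon> r(1) by (auto simp: \<omega>_def intro!: divide_pos_pos mult_pos_pos)
  have "uniformly_continuous_on Kr \<psi>"
    using Kr cont Kr\<Omega> by (meson compact_uniformly_continuous continuous_on_subset)
  then obtain \<delta> where \<delta>: "\<delta> > 0"
    "\<And>x y. x \<in> Kr \<Longrightarrow> y \<in> Kr \<Longrightarrow> dist y x < \<delta> \<Longrightarrow> dist (\<psi> y) (\<psi> x) < \<omega>"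
    using \<omega> unfolding uniformly_continuous_on_def by metis
  \<comment> \<open>Equal to 1 on \<open>K\<close>, zero from distance \<open>r / 2\<close> on, with
    Lipschitz constant \<open>2 / r\<close>.\<close>
  define \<eta> where "\<eta> y = max 0 (1 - (2 / r) * infdist y K)" for y
  have [measurable]: "\<eta> \<in> borel_measurable borel"
    unfolding \<eta>_def by (intro borel_measurable_continuous_onI continuous_intros)
  have \<eta>01: "0 \<le> \<eta> y" "\<eta> y \<le> 1" for y using r(1) by (auto simp: \<eta>_def infdist_nonneg)
  have \<eta>K: "\<eta> y = 1" if "y \<in> K" for y using that by (simp add: \<eta>_def)
  have \<eta>_supp: "infdist y K < r / 2" if "\<eta> y \<noteq> 0" for y
    using that r(1) by (auto simp: \<eta>_def max_def field_simps split: if_splits)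
  have \<eta>_lip: "\<bar>\<eta> x - \<eta> y\<bar> \<le> (2 / r) * dist x y" for x y
  proof -
    have "\<bar>\<eta> x - \<eta> y\<bar> \<le> \<bar>(2 / r) * infdist x K - (2 / r) * infdist y K\<bar>"
      by (auto simp: \<eta>_def)
    also have "\<dots> = (2 / r) * \<bar>infdist x K - infdist y K\<bar>"
      unfolding right_diff_distrib[symmetric] abs_mult using r(1) by simp
    also have "\<dots> \<le> (2 / r) * dist x y"
      using r(1) infdist_triangle_abs[of x K y] by (intro mult_left_mono) auto
    finally show ?thesis .
  qed
  \<comment> \<open>Cutting \<open>\<psi>\<close> off outside \<open>Kr\<close> makes it integrable
    on the whole space. Since \<open>t < r / 4\<close>, points within \<open>r / 2 + t\<close> of
    \<open>K\<close> stay in \<open>Kr\<close> when shifted by \<open>t\<close> in either direction,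
    so the cutoff is invisible wherever it matters.\<close>
  define f where "f y = indicator Kr y *\<^sub>R \<psi> y" for y
  have fint: "integrable lborel f"
    unfolding f_def using Kr continuous_on_subset[OF cont Kr\<Omega>] by (rule borel_integrable_compact)
  then have [measurable]: "f \<in> borel_measurable borel" by (simp add: borel_measurable_integrable)
  define t0 where "t0 = min \<delta> (r / 4)"
  have near: "y \<in> Kr" "y + t *\<^sub>R e \<in> Kr" "y - t *\<^sub>R e \<in> Kr"
    if "0 < t" "t < t0" "infdist y K < r / 2 + t" for t y
  proof -
    have "\<bar>infdist (y + t *\<^sub>R e) K - infdist y K\<bar> \<le> t" "\<bar>infdist (y - t *\<^sub>R e) K - infdist y K\<bar> \<le> t"
      using infdist_triangle_abs[of "y + t *\<^sub>R e" K y] infdist_triangle_abs[of "y - t *\<^sub>R e" K y] that e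
      by (auto simp: dist_norm)
    then show "y \<in> Kr" "y + t *\<^sub>R e \<in> Kr" "y - t *\<^sub>R e \<in> Kr"
      using that by (auto simp: Kr_def t0_def)
  qed
  show thesis
  proof (rule that)
    show "t0 > 0" using \<delta>(1) r(1) by (simp add: t0_def)
    show "y + t *\<^sub>R e \<in> \<Omega> \<and> y - t *\<^sub>R e \<in> \<Omega>" if "0 < t" "t < t0" "y \<in> K" for t y
    proof -
      have "infdist y K < r / 2 + t" using that r(1) by simp
      then show ?thesis using near[OF that(1,2), of y] Kr\<Omega> by blast
    qed
    fix t assume t: "0 < t" "t < t0"
    define \<Delta> where "\<Delta> y = f (y + t *\<^sub>R e) - f y" for y
    have [measurable]: "\<Delta> \<in> borel_measurable borel" unfolding \<Delta>_def by measurable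
    have \<Delta>int: "integrable lborel \<Delta>"
      unfolding \<Delta>_def using fint by (intro Bochner_Integration.integrable_diff lborel_integral_translate) auto
    have int1: "integrable lborel (\<lambda>y. \<eta> y * \<Delta> y)"
      using \<Delta>int by (rule Bochner_Integration.integrable_bound) (auto simp: abs_mult \<eta>01 mult_left_le_one_le)
    have int2: "integrable lborel (\<lambda>y. \<eta> (y + t *\<^sub>R e) * \<Delta> y)"
      using \<Delta>int by (rule Bochner_Integration.integrable_bound) (auto simp: abs_mult \<eta>01 mult_left_le_one_le)
    have int2': "integrable lborel (\<lambda>y. \<eta> y * \<Delta> (y - t *\<^sub>R e))"
      using lborel_integral_translate(2)[OF _ int2, of "- t *\<^sub>R e"] by simp
    have q: "\<eta> y * (\<Delta> y - \<Delta> (y - t *\<^sub>R e)) = \<eta> y * (\<psi> (y + t *\<^sub>R e) + \<psi> (y - t *\<^sub>R e) - 2 * \<psi> y)"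
      and q_nonneg: "\<eta> y * (\<Delta> y - \<Delta> (y - t *\<^sub>R e)) \<ge> 0" for y
    proof -
      have *: "\<Delta> y - \<Delta> (y - t *\<^sub>R e) = \<psi> (y + t *\<^sub>R e) + \<psi> (y - t *\<^sub>R e) - 2 * \<psi> y
         \<and> \<Delta> y - \<Delta> (y - t *\<^sub>R e) \<ge> 0" if nz: "\<eta> y \<noteq> 0"
      proof -
        have n: "y \<in> Kr" "y + t *\<^sub>R e \<in> Kr" "y - t *\<^sub>R e \<in> Kr"
          using near[OF t, of y] \<eta>_supp[OF nz] t by auto
        have "\<psi> ((1 - 1/2) *\<^sub>R (y - t *\<^sub>R e) + (1/2) *\<^sub>R (y + t *\<^sub>R e)) \<le> (1 - 1/2) * \<psi> (y - t *\<^sub>R e) + (1/2) * \<psi> (y + t *\<^sub>R e)"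
          using n Kr\<Omega> by (intro convex_onD[OF cvx]) auto
        also have "(1 - 1/2) *\<^sub>R (y - t *\<^sub>R e) + (1/2) *\<^sub>R (y + t *\<^sub>R e) = y"
          by (simp add: scaleR_diff_right scaleR_add_right flip: scaleR_add_left)
        finally show ?thesis using n by (simp add: \<Delta>_def f_def)
      qed
      show "\<eta> y * (\<Delta> y - \<Delta> (y - t *\<^sub>R e)) = \<eta> y * (\<psi> (y + t *\<^sub>R e) + \<psi> (y - t *\<^sub>R e) - 2 * \<psi> y)"
        "\<eta> y * (\<Delta> y - \<Delta> (y - t *\<^sub>R e)) \<ge> 0"
        using * \<eta>01(1)[of y] by (cases "\<eta> y = 0"; simp)+
    qed
    have "(\<integral>y. \<eta> y * (\<Delta> y - \<Delta> (y - t *\<^sub>R e)) \<partial>lborel) = (\<integral>y. \<eta> y * \<Delta> y \<partial>lborel) - (\<integral>y. \<eta> y * \<Delta> (y - t *\<^sub>R e) \<partial>lborel)"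
      using int1 int2' by (simp add: right_diff_distrib)
    \<comment> \<open>Summation by parts: translating the variable moves the shift from
      \<open>\<Delta>\<close> onto \<open>\<eta>\<close>.\<close>
    also have "(\<integral>y. \<eta> y * \<Delta> (y - t *\<^sub>R e) \<partial>lborel) = (\<integral>y. \<eta> (y + t *\<^sub>R e) * \<Delta> y \<partial>lborel)"
      using lborel_integral_translate(1)[of "\<lambda>y. \<eta> y * \<Delta> (y - t *\<^sub>R e)" "t *\<^sub>R e"] by simp
    also have "(\<integral>y. \<eta> y * \<Delta> y \<partial>lborel) - (\<integral>y. \<eta> (y + t *\<^sub>R e) * \<Delta> y \<partial>lborel)
        = (\<integral>y. (\<eta> y - \<eta> (y + t *\<^sub>R e)) * \<Delta> y \<partial>lborel)"
      using int1 int2 by (simp add: left_diff_distrib)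
    also have "\<dots> \<le> (\<integral>y. indicator Kr y * (2 / r * t * \<omega>) \<partial>lborel)"
    proof (rule integral_mono)
      show "integrable lborel (\<lambda>y. (\<eta> y - \<eta> (y + t *\<^sub>R e)) * \<Delta> y)"
        using int1 int2 by (simp add: left_diff_distrib)
      show "integrable lborel (\<lambda>y. indicator Kr y * (2 / r * t * \<omega>))"
        using emKr by simp
      fix y
      have "\<bar>(\<eta> y - \<eta> (y + t *\<^sub>R e)) * \<Delta> y\<bar> \<le> indicator Kr y * (2 / r * t * \<omega>)"
      proof (cases "\<eta> y = 0 \<and> \<eta> (y + t *\<^sub>R e) = 0")
        case True
        then show ?thesis using r(1) t \<omega> by simp
      next
        case False
        have "infdist y K < r / 2 + t"
        proof (cases "\<eta> y = 0")
          case True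
          with False have "infdist (y + t *\<^sub>R e) K < r / 2" using \<eta>_supp by blast
          moreover have "\<bar>infdist (y + t *\<^sub>R e) K - infdist y K\<bar> \<le> t"
            using infdist_triangle_abs[of "y + t *\<^sub>R e" K y] t e by (simp add: dist_norm)
          ultimately show ?thesis by linarith
        next
          case False
          then show ?thesis using \<eta>_supp[of y] t by simp
        qed
        then have n: "y \<in> Kr" "y + t *\<^sub>R e \<in> Kr" using near[OF t, of y] by auto
        then have "\<bar>\<Delta> y\<bar> \<le> \<omega>"
          using \<delta>(2)[of y "y + t *\<^sub>R e"] t e by (simp add: \<Delta>_def f_def dist_norm t0_def)
        moreover have "\<bar>\<eta> y - \<eta> (y + t *\<^sub>R e)\<bar> \<le> 2 / r * t"
          using \<eta>_lip[of y "y + t *\<^sub>R e"] t e by (simp add: dist_norm)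
        ultimately have "\<bar>(\<eta> y - \<eta> (y + t *\<^sub>R e)) * \<Delta> y\<bar> \<le> (2 / r * t) * \<omega>"
          using r(1) t unfolding abs_mult by (intro mult_mono) auto
        then show ?thesis using n by simp
      qed
      then show "(\<eta> y - \<eta> (y + t *\<^sub>R e)) * \<Delta> y \<le> indicator Kr y * (2 / r * t * \<omega>)" by linarith
    qed
    also have "\<dots> = vol * (2 / r * t * \<omega>)" by (simp add: vol_def)
    also have "\<dots> = t * (\<epsilon> * (vol / (vol + 1)))"
      using r(1) vol unfolding \<omega>_def by (simp add: field_simps)
    also have "\<dots> \<le> t * (\<epsilon> * 1)"
      using t \<epsilon> vol by (intro mult_left_mono) auto
    finally have I: "(\<integral>y. \<eta> y * (\<Delta> y - \<Delta> (y - t *\<^sub>R e)) \<partial>lborel) \<le> t * \<epsilon>" by simp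
    have "(\<integral>\<^sup>+ y. indicator K y * ennreal ((\<psi> (y + t *\<^sub>R e) + \<psi> (y - t *\<^sub>R e) - 2 * \<psi> y) / t) \<partial>lborel)
        \<le> (\<integral>\<^sup>+ y. ennreal (\<eta> y * (\<Delta> y - \<Delta> (y - t *\<^sub>R e)) / t) \<partial>lborel)"
    proof (rule nn_integral_mono)
      fix y
      show "indicator K y * ennreal ((\<psi> (y + t *\<^sub>R e) + \<psi> (y - t *\<^sub>R e) - 2 * \<psi> y) / t)
         \<le> ennreal (\<eta> y * (\<Delta> y - \<Delta> (y - t *\<^sub>R e)) / t)"
        unfolding q using \<eta>K[of y] by (cases "y \<in> K") auto
    qed
    also have "\<dots> = ennreal (\<integral>y. \<eta> y * (\<Delta> y - \<Delta> (y - t *\<^sub>R e)) / t \<partial>lborel)"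
      using int1 int2' q_nonneg t by (intro nn_integral_eq_integral) (auto simp: right_diff_distrib)
    also have "\<dots> \<le> ennreal \<epsilon>"
      using I t by (intro ennreal_leI) (simp add: field_simps)
    finally show "(\<integral>\<^sup>+ y. indicator K y * ennreal ((\<psi> (y + t *\<^sub>R e) + \<psi> (y - t *\<^sub>R e) - 2 * \<psi> y) / t) \<partial>lborel) \<le> ennreal \<epsilon>" .
  qed
qed

section \<open>Measures determined by couplings of small slack\<close>

lemma couplingsD:
  assumes "\<pi> \<in> couplings \<mu> \<nu>"
  shows "\<pi> \<in> prob_measures" "distr \<pi> borel fst = \<mu>" "distr \<pi> borel snd = \<nu>"
    "fst \<in> borel_measurable \<pi>" "snd \<in> borel_measurable \<pi>"
proof -
  show P: "\<pi> \<in> prob_measures" and "distr \<pi> borel fst = \<mu>" "distr \<pi> borel snd = \<nu>"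
    using assms by (auto simp: couplings_def)
  have [measurable_cong]: "sets \<pi> = sets borel" using P by (rule prob_measuresD)
  show "fst \<in> borel_measurable \<pi>" "snd \<in> borel_measurable \<pi>" by measurable
qed

text \<open>The indicator of a nonempty closed set is the pointwise limit of bounded Lipschitz
  cutoffs of the distance to it, and closed sets are an intersection-stable generator of the Borel
  sets.\<close>

lemma measure_eqI_Lipschitz:
  fixes \<mu> \<nu> :: "'a::metric_space measure"
  assumes P: "\<mu> \<in> prob_measures" "\<nu> \<in> prob_measures"
    and eq: "\<And>u M L. (\<And>x. \<bar>u x\<bar> \<le> M) \<Longrightarrow> (\<And>x y. \<bar>u x - u y\<bar> \<le> L * dist x y) \<Longrightarrow>
       u \<in> borel_measurable borel \<Longrightarrow> (\<integral>x. u x \<partial>\<mu>) = (\<integral>x. u x \<partial>\<nu>)"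
  shows "\<mu> = \<nu>"
proof -
  interpret \<mu>: prob_space \<mu> using P(1) by (rule prob_measuresD)
  interpret \<nu>: prob_space \<nu> using P(2) by (rule prob_measuresD)
  have sets[simp, measurable_cong]: "sets \<mu> = sets borel" "sets \<nu> = sets borel"
    and sp[simp]: "space \<mu> = UNIV" "space \<nu> = UNIV"
    using P by (auto dest: prob_measuresD)
  have closed_eq: "emeasure \<mu> C = emeasure \<nu> C" if C: "closed C" for C
  proof (cases "C = {}")
    case False
    define u where "u n x = max 0 (1 - real n * infdist x C)" for n x
    have um[measurable]: "u n \<in> borel_measurable borel" for n
      unfolding u_def by (intro borel_measurable_continuous_onI continuous_intros)
    have ub: "\<bar>u n x\<bar> \<le> 1" for n x by (simp add: u_def infdist_nonneg)
    have ul: "\<bar>u n x - u n y\<bar> \<le> real n * dist x y" for n x y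
    proof -
      have "\<bar>u n x - u n y\<bar> \<le> \<bar>real n * infdist x C - real n * infdist y C\<bar>"
        by (auto simp: u_def)
      also have "\<dots> = real n * \<bar>infdist x C - infdist y C\<bar>"
        unfolding right_diff_distrib[symmetric] abs_mult by simp
      also have "\<dots> \<le> real n * dist x y"
        using infdist_triangle_abs[of x C y] by (intro mult_left_mono) auto
      finally show ?thesis .
    qed
    have lim: "(\<lambda>n. u n x) \<longlonglongrightarrow> indicator C x" for x
    proof (cases "x \<in> C")
      case True
      then show ?thesis by (simp add: u_def)
    next
      case x: False
      then have pos: "infdist x C > 0"
        using in_closed_iff_infdist_zero[OF C False, of x] infdist_nonneg[of x C] by simp
      then obtain n0 where n0: "1 < real n0 * infdist x C" using reals_Archimedean3 by blast
      have "eventually (\<lambda>n. u n x = 0) sequentially"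
        using eventually_ge_at_top[of n0]
      proof eventually_elim
        fix n assume "n0 \<le> n"
        then have "real n0 * infdist x C \<le> real n * infdist x C" using pos by (intro mult_right_mono) auto
        then show "u n x = 0" using n0 by (simp add: u_def)
      qed
      then show ?thesis using x by (simp add: tendsto_eventually)
    qed
    have Cm[measurable]: "C \<in> sets borel" using C by simp
    have "(\<lambda>n. \<integral>x. u n x \<partial>\<mu>) \<longlonglongrightarrow> (\<integral>x. indicator C x \<partial>\<mu>)"
      by (rule integral_dominated_convergence[where w = "\<lambda>_. 1"]) (use ub lim in auto)
    moreover have "(\<lambda>n. \<integral>x. u n x \<partial>\<nu>) \<longlonglongrightarrow> (\<integral>x. indicator C x \<partial>\<nu>)"
      by (rule integral_dominated_convergence[where w = "\<lambda>_. 1"]) (use ub lim in auto)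
    moreover have "(\<integral>x. u n x \<partial>\<mu>) = (\<integral>x. u n x \<partial>\<nu>)" for n
      using ub ul um by (rule eq)
    ultimately have "measure \<mu> C = measure \<nu> C"
      by (simp add: LIMSEQ_unique)
    then show ?thesis by (simp add: \<mu>.emeasure_eq_measure \<nu>.emeasure_eq_measure)
  qed simp
  show ?thesis
  proof (rule measure_eqI_generator_eq[where E = "Collect closed" and A = "\<lambda>_. UNIV" and \<Omega> = UNIV])
    show "Int_stable (Collect closed :: 'a set set)" by (auto simp: Int_stable_def)
    show "sets \<mu> = sigma_sets UNIV (Collect closed)" "sets \<nu> = sigma_sets UNIV (Collect closed)"
      by (simp_all add: borel_eq_closed)
  qed (use closed_eq in \<open>auto simp: \<mu>.emeasure_eq_measure\<close>)
qed

text \<open>\<open>I\<close> and \<open>\<eta>\<close> are fixed before \<open>\<nu>\<close> and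
  \<open>\<pi>\<close>. Hence two measures that both admit couplings of slack at most
  \<open>\<eta>\<close> have integrals within \<open>2 * \<epsilon>\<close> of each other, without
  any optimal coupling or any differentiability of \<open>\<psi>\<close>. The number
  \<open>I\<close> is the integral against \<open>D\<close> of \<open>u\<close> evaluated at a
  discrete gradient of \<open>\<psi>\<close>, restricted to a compact set.\<close>

lemma coupling_slack_determines_integral:
  fixes \<phi> \<psi> u :: "'a::euclidean_space \<Rightarrow> real"
  assumes D: "D \<in> prob_measures" "D = density lborel (\<lambda>x. ennreal (g x))"
      "g \<in> borel_measurable borel" "\<And>x. g x \<le> B" "AE y in D. y \<in> \<Omega>"
    and \<Omega>: "open \<Omega>" and cvx: "convex_on \<Omega> \<psi>"
    and [measurable]: "\<psi> \<in> borel_measurable borel" "\<phi> \<in> borel_measurable borel"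
    and young: "\<And>y z. y \<in> \<Omega> \<Longrightarrow> y \<bullet> z \<le> \<phi> z + \<psi> y"
    and u: "\<And>x. \<bar>u x\<bar> \<le> M" "\<And>x y. \<bar>u x - u y\<bar> \<le> L * dist x y" "u \<in> borel_measurable borel"
    and \<epsilon>: "0 < \<epsilon>"
  obtains I \<eta> where "\<eta> > 0"
    "\<And>\<nu> \<pi>. \<pi> \<in> couplings D \<nu> \<Longrightarrow>
       (\<integral>\<^sup>+ (y, z). ennreal (\<phi> z + \<psi> y - y \<bullet> z) \<partial>\<pi>) \<le> ennreal \<eta> \<Longrightarrow> \<bar>(\<integral>x. u x \<partial>\<nu>) - I\<bar> \<le> \<epsilon>"
proof -
  interpret D: prob_space D using D(1) by (rule prob_measuresD)
  have [simp, measurable_cong]: "sets D = sets borel" and [simp]: "space D = UNIV"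
    using D(1) by (auto dest: prob_measuresD)
  note [measurable] = u(3) D(3)
  have cont: "continuous_on \<Omega> \<psi>" using \<Omega> cvx by (rule convex_on_continuous)
  have M: "M \<ge> 0" using u(1)[of undefined] by linarith
  define L' where "L' = max L 0"
  have L': "L' \<ge> 0" "\<bar>u x - u y\<bar> \<le> L' * dist x y" for x y
    using u(2)[of x y] mult_right_mono[of L L' "dist x y"] by (auto simp: L'_def)
  define B' where "B' = max B 0"
  have B': "B' \<ge> 0" "ennreal (g x) \<le> ennreal B'" for x
    using D(4)[of x] by (auto simp: B'_def intro!: ennreal_leI)
  define d where "d = real DIM('a)"
  have d: "d > 0" by (simp add: d_def)
  \<comment> \<open>The error has three sources, each allotted \<open>\<epsilon> / 3\<close>: mass
    of \<open>D\<close> outside \<open>K\<close>, second differences of \<open>\<psi>\<close> on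
    \<open>K\<close>, and the slack. The last one is settled by the choice of
    \<open>\<eta>\<close>.\<close>
  define \<epsilon>1 where "\<epsilon>1 = \<epsilon> / (3 * (M + 1))"
  define \<epsilon>2 where "\<epsilon>2 = \<epsilon> / (3 * d * (L' + 1) * (B' + 1))"
  have \<epsilon>12: "\<epsilon>1 > 0" "\<epsilon>2 > 0" using \<epsilon> M L' B' d by (auto simp: \<epsilon>1_def \<epsilon>2_def)
  have [measurable]: "\<Omega> \<in> sets borel" using \<Omega> by simp
  have D\<Omega>: "emeasure D \<Omega> = 1"
    using D(5) by (intro D.emeasure_eq_1_AE) auto
  have "emeasure D \<Omega> = (SUP K\<in>{K. K \<subseteq> \<Omega> \<and> compact K}. emeasure D K)"
    by (rule inner_regular) auto
  then have "ennreal (1 - \<epsilon>1) < (SUP K\<in>{K. K \<subseteq> \<Omega> \<and> compact K}. emeasure D K)"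
    using \<epsilon>12 unfolding D\<Omega> by (metis diff_gt_0_iff_gt diff_add_cancel ennreal_1 ennreal_lessI less_add_same_cancel1 zero_less_one)
  then obtain K where K: "K \<subseteq> \<Omega>" "compact K" "ennreal (1 - \<epsilon>1) < emeasure D K"
    unfolding less_SUP_iff by blast
  have [measurable]: "K \<in> sets borel" using K by (auto intro: borel_compact)
  have "1 - \<epsilon>1 < measure D K"
    using K(3) by (cases "1 - \<epsilon>1 \<ge> 0") (auto simp: D.emeasure_eq_measure ennreal_less_iff intro: less_le_trans[OF _ measure_nonneg])
  then have DK: "emeasure D (- K) \<le> ennreal \<epsilon>1"
    using D.prob_compl[of K] by (auto simp: D.emeasure_eq_measure Compl_eq_Diff_UNIV intro!: ennreal_leI)
  define P where "P e t0 \<longleftrightarrow> t0 > 0 \<and>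
      (\<forall>t y. 0 < t \<longrightarrow> t < t0 \<longrightarrow> y \<in> K \<longrightarrow> y + t *\<^sub>R e \<in> \<Omega> \<and> y - t *\<^sub>R e \<in> \<Omega>) \<and>
      (\<forall>t. 0 < t \<longrightarrow> t < t0 \<longrightarrow> (\<integral>\<^sup>+ y. indicator K y * ennreal ((\<psi> (y + t *\<^sub>R e) + \<psi> (y - t *\<^sub>R e) - 2 * \<psi> y) / t) \<partial>lborel) \<le> ennreal \<epsilon>2)"
    for e :: 'a and t0
  have "\<forall>e\<in>Basis. \<exists>t0. P e t0"
  proof
    fix e :: 'a assume "e \<in> Basis"
    then have "norm e = 1" by simp
    show "\<exists>t0. P e t0"
      by (rule second_difference_tendsto_0[OF \<Omega> K(2,1) cvx cont \<open>norm e = 1\<close> \<epsilon>12(2)])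
        (auto simp: P_def)
  qed
  then obtain \<tau> where \<tau>: "\<And>e. e \<in> Basis \<Longrightarrow> P e (\<tau> e)" by metis
  \<comment> \<open>One step size valid for all coordinate directions; halving makes it strictly
    smaller than each \<open>\<tau> e\<close>.\<close>
  define t where "t = Min (\<tau> ` Basis) / 2"
  have Min_pos: "Min (\<tau> ` Basis) > 0" using \<tau> by (subst Min_gr_iff) (auto simp: P_def)
  then have t: "0 < t" by (simp add: t_def)
  have t\<tau>: "t < \<tau> e" if "e \<in> Basis" for e
  proof -
    have "Min (\<tau> ` Basis) \<le> \<tau> e" using that by (intro Min_le) auto
    then show ?thesis using Min_pos unfolding t_def by linarith
  qed
  \<comment> \<open>\<open>b y\<close> collects the forward difference quotients of
    \<open>\<psi>\<close>, and \<open>q e y\<close> is the forward minus the backward quotient in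
    direction \<open>e\<close>.\<close>
  define q where "q e y = (\<psi> (y + t *\<^sub>R e) + \<psi> (y - t *\<^sub>R e) - 2 * \<psi> y) / t" for e y
  define b where "b y = (\<Sum>e\<in>Basis. ((\<psi> (y + t *\<^sub>R e) - \<psi> y) / t) *\<^sub>R e)" for y
  define v where "v y = indicator K y * u (b y)" for y
  have [measurable]: "q e \<in> borel_measurable borel" "b \<in> borel_measurable borel" for e
    unfolding q_def b_def by measurable
  have [measurable]: "v \<in> borel_measurable borel" unfolding v_def by measurable
  have in\<Omega>: "y + t *\<^sub>R e \<in> \<Omega>" "y - t *\<^sub>R e \<in> \<Omega>" if "y \<in> K" "e \<in> Basis" for y e
    using \<tau>[OF that(2)] t t\<tau>[OF that(2)] that(1) by (auto simp: P_def)
  have qint: "(\<integral>\<^sup>+ y. indicator K y * ennreal (q e y) \<partial>lborel) \<le> ennreal \<epsilon>2" if "e \<in> Basis" for e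
    using \<tau>[OF that] t t\<tau>[OF that] by (simp add: P_def q_def)
  have qD: "(\<integral>\<^sup>+ y. indicator K y * ennreal (q e y) \<partial>D) \<le> ennreal (B' * \<epsilon>2)" if "e \<in> Basis" for e
  proof -
    have "(\<integral>\<^sup>+ y. indicator K y * ennreal (q e y) \<partial>D) = (\<integral>\<^sup>+ y. ennreal (g y) * (indicator K y * ennreal (q e y)) \<partial>lborel)"
      unfolding D(2) by (rule nn_integral_density) measurable
    also have "\<dots> \<le> (\<integral>\<^sup>+ y. ennreal B' * (indicator K y * ennreal (q e y)) \<partial>lborel)"
      by (intro nn_integral_mono mult_right_mono B') auto
    also have "\<dots> = ennreal B' * (\<integral>\<^sup>+ y. indicator K y * ennreal (q e y) \<partial>lborel)"
      by (rule nn_integral_cmult) measurable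
    also have "\<dots> \<le> ennreal B' * ennreal \<epsilon>2" by (intro mult_left_mono qint that) auto
    finally show ?thesis using B' \<epsilon>12 by (simp add: ennreal_mult)
  qed
  define s where "s y z = \<phi> z + \<psi> y - y \<bullet> z" for y z
  \<comment> \<open>Young's inequality at \<open>y + t *\<^sub>R e\<close> and at
    \<open>y - t *\<^sub>R e\<close> places \<open>z \<bullet> e\<close> between the backward and
    the forward quotient, up to an error \<open>s y z / t\<close>.\<close>
  have close: "norm (z - b y) \<le> (\<Sum>e\<in>Basis. q e y + s y z / t)" if y: "y \<in> K" for y z
  proof -
    have "norm (z - b y) \<le> (\<Sum>e\<in>Basis. \<bar>(z - b y) \<bullet> e\<bar>)" by (rule norm_le_l1)
    also have "\<dots> \<le> (\<Sum>e\<in>Basis. q e y + s y z / t)"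
    proof (rule sum_mono)
      fix e :: 'a assume e: "e \<in> Basis"
      have be: "b y \<bullet> e = (\<psi> (y + t *\<^sub>R e) - \<psi> y) / t"
        unfolding b_def using e by (simp add: inner_sum_left_Basis)
      have 1: "y \<bullet> z + t * (z \<bullet> e) \<le> \<phi> z + \<psi> (y + t *\<^sub>R e)"
        using young[OF in\<Omega>(1)[OF y e], of z] by (simp add: inner_simps inner_commute[of z e])
      have 2: "y \<bullet> z - t * (z \<bullet> e) \<le> \<phi> z + \<psi> (y - t *\<^sub>R e)"
        using young[OF in\<Omega>(2)[OF y e], of z] by (simp add: inner_simps inner_commute[of z e])
      have 3: "s y z \<ge> 0" using young[of y z] y K(1) by (auto simp: s_def)
      have "\<psi> ((1 - 1/2) *\<^sub>R (y - t *\<^sub>R e) + (1/2) *\<^sub>R (y + t *\<^sub>R e)) \<le> (1 - 1/2) * \<psi> (y - t *\<^sub>R e) + (1/2) * \<psi> (y + t *\<^sub>R e)"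
        using in\<Omega>[OF y e] by (intro convex_onD[OF cvx]) auto
      also have "(1 - 1/2) *\<^sub>R (y - t *\<^sub>R e) + (1/2) *\<^sub>R (y + t *\<^sub>R e) = y"
        by (simp add: scaleR_diff_right scaleR_add_right flip: scaleR_add_left)
      finally have 4: "2 * \<psi> y \<le> \<psi> (y - t *\<^sub>R e) + \<psi> (y + t *\<^sub>R e)" by simp
      have "t * \<bar>(z - b y) \<bullet> e\<bar> = \<bar>t * (z \<bullet> e) - (\<psi> (y + t *\<^sub>R e) - \<psi> y)\<bar>"
        using t unfolding inner_diff_left be by (simp add: abs_mult_pos' field_simps)
      also have "\<dots> \<le> (\<psi> (y + t *\<^sub>R e) + \<psi> (y - t *\<^sub>R e) - 2 * \<psi> y) + s y z"
        using 1 2 3 4 unfolding s_def abs_le_iff by linarith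
      also have "\<dots> = t * (q e y + s y z / t)"
        using t by (simp add: q_def field_simps)
      finally show "\<bar>(z - b y) \<bullet> e\<bar> \<le> q e y + s y z / t"
        using t by simp
    qed
    finally show ?thesis .
  qed
  \<comment> \<open>Outside \<open>K\<close> the function \<open>v\<close> vanishes and the bound
    \<open>M\<close> is all that is used; on \<open>K\<close> the Lipschitz property of
    \<open>u\<close> turns \<open>close\<close> into an estimate.\<close>
  have bound: "ennreal \<bar>u z - v y\<bar> \<le> ennreal M * indicator (- K) y
      + (ennreal L' * (\<Sum>e\<in>Basis. indicator K y * ennreal (q e y)) + ennreal (L' * d / t) * ennreal (s y z))"
    if y: "y \<in> \<Omega>" for y z
  proof (cases "y \<in> K")
    case False
    then show ?thesis using u(1)[of z] M by (auto simp: v_def intro!: add_increasing2 ennreal_leI)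
  next
    case True
    have s0: "s y z \<ge> 0" using young[OF y, of z] by (simp add: s_def)
    have "\<bar>u z - v y\<bar> \<le> L' * dist z (b y)" using True L'(2) by (simp add: v_def)
    also have "\<dots> \<le> L' * (\<Sum>e\<in>Basis. q e y + s y z / t)"
      using close[OF True] L'(1) by (intro mult_left_mono) (auto simp: dist_norm)
    also have "\<dots> \<le> L' * (\<Sum>e\<in>Basis. max 0 (q e y) + s y z / t)"
      using L'(1) by (intro mult_left_mono sum_mono) auto
    also have "\<dots> = L' * (\<Sum>e\<in>Basis. max 0 (q e y)) + L' * d / t * s y z"
      by (simp add: sum.distrib d_def algebra_simps)
    finally have "ennreal \<bar>u z - v y\<bar> \<le> ennreal (L' * (\<Sum>e\<in>Basis. max 0 (q e y)) + L' * d / t * s y z)"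
      by (rule ennreal_leI)
    also have "\<dots> = ennreal L' * ennreal (\<Sum>e\<in>Basis. max 0 (q e y)) + ennreal (L' * d / t) * ennreal (s y z)"
      using L'(1) s0 d t by (simp add: ennreal_plus sum_nonneg ennreal_mult[symmetric])
    also have "ennreal (\<Sum>e\<in>Basis. max 0 (q e y)) = (\<Sum>e\<in>Basis. indicator K y * ennreal (q e y))"
      using True by (subst sum_ennreal[symmetric]) (auto simp: ennreal_max_0')
    finally show ?thesis using True by simp
  qed
  \<comment> \<open>Makes \<open>L' * d / t * \<eta>\<close> equal to \<open>\<epsilon> / 3\<close>
    times \<open>L' / (L' + 1)\<close>. It depends on \<open>t\<close>, hence has to be chosen after
    the step size.\<close>
  define \<eta> where "\<eta> = \<epsilon> * t / (3 * d * (L' + 1))"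
  have \<eta>: "\<eta> > 0" using \<epsilon> t d L' by (auto simp: \<eta>_def)
  show thesis
  proof (rule that[OF \<eta>])
    fix \<nu> \<pi>
    assume \<pi>: "\<pi> \<in> couplings D \<nu>"
      and slack: "(\<integral>\<^sup>+ (y, z). ennreal (\<phi> z + \<psi> y - y \<bullet> z) \<partial>\<pi>) \<le> ennreal \<eta>"
    note c = couplingsD[OF \<pi>]
    interpret \<pi>: prob_space \<pi> using c(1) by (rule prob_measuresD)
    have [simp, measurable_cong]: "sets \<pi> = sets borel" using c(1) by (rule prob_measuresD)
    have AE\<Omega>: "AE p in \<pi>. fst p \<in> \<Omega>"
      using D(5) unfolding c(2)[symmetric] by (rule AE_distrD[OF c(4)])
    have bnd: "\<bar>u (snd p) - v (fst p)\<bar> \<le> 2 * M" for p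
      using u(1)[of "snd p"] u(1)[of "b (fst p)"] M by (auto simp: v_def indicator_def)
    have vb: "\<bar>v y\<bar> \<le> M" for y
      using u(1)[of "b y"] M by (auto simp: v_def indicator_def)
    have int1: "integrable \<pi> (\<lambda>p. u (snd p))"
      by (rule \<pi>.integrable_const_bound[of _ M]) (use u(1) in auto)
    have int2: "integrable \<pi> (\<lambda>p. v (fst p))"
      by (rule \<pi>.integrable_const_bound[of _ M]) (use vb in auto)
    have "(\<integral>x. u x \<partial>\<nu>) = (\<integral>p. u (snd p) \<partial>\<pi>)"
      unfolding c(3)[symmetric] by (rule integral_distr[OF c(5)]) measurable
    moreover have "(\<integral>y. v y \<partial>D) = (\<integral>p. v (fst p) \<partial>\<pi>)"
      unfolding c(2)[symmetric] by (rule integral_distr[OF c(4)]) measurable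
    ultimately have "(\<integral>x. u x \<partial>\<nu>) - (\<integral>y. v y \<partial>D) = (\<integral>p. u (snd p) - v (fst p) \<partial>\<pi>)"
      using int1 int2 by simp
    then have "ennreal \<bar>(\<integral>x. u x \<partial>\<nu>) - (\<integral>y. v y \<partial>D)\<bar> \<le> (\<integral>\<^sup>+ p. ennreal \<bar>u (snd p) - v (fst p)\<bar> \<partial>\<pi>)"
      using integral_norm_bound_ennreal[OF Bochner_Integration.integrable_diff[OF int1 int2]] by simp
    also have "\<dots> \<le> (\<integral>\<^sup>+ p. ennreal M * indicator (- K) (fst p)
        + (ennreal L' * (\<Sum>e\<in>Basis. indicator K (fst p) * ennreal (q e (fst p)))
          + ennreal (L' * d / t) * ennreal (s (fst p) (snd p))) \<partial>\<pi>)"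
      by (intro nn_integral_mono_AE eventually_mono[OF AE\<Omega>] bound)
    also have "\<dots> = ennreal M * (\<integral>\<^sup>+ p. indicator (- K) (fst p) \<partial>\<pi>)
        + (ennreal L' * (\<Sum>e\<in>Basis. \<integral>\<^sup>+ p. indicator K (fst p) * ennreal (q e (fst p)) \<partial>\<pi>)
          + ennreal (L' * d / t) * (\<integral>\<^sup>+ p. ennreal (s (fst p) (snd p)) \<partial>\<pi>))"
      unfolding s_def by (simp add: nn_integral_add nn_integral_cmult nn_integral_sum del: sum_indicator_mult)
    also have "(\<integral>\<^sup>+ p. indicator (- K) (fst p) \<partial>\<pi>) = emeasure D (- K)"
      unfolding c(2)[symmetric] by (rule emeasure_distr_nn_integral[OF c(4), symmetric]) simp
    also have "(\<Sum>e\<in>Basis. \<integral>\<^sup>+ p. indicator K (fst p) * ennreal (q e (fst p)) \<partial>\<pi>)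
        = (\<Sum>e\<in>Basis. \<integral>\<^sup>+ y. indicator K y * ennreal (q e y) \<partial>D)"
      unfolding c(2)[symmetric] by (intro sum.cong refl nn_integral_distr[OF c(4), symmetric]) simp
    also have "ennreal M * emeasure D (- K)
        + (ennreal L' * (\<Sum>e\<in>Basis. \<integral>\<^sup>+ y. indicator K y * ennreal (q e y) \<partial>D)
          + ennreal (L' * d / t) * (\<integral>\<^sup>+ p. ennreal (s (fst p) (snd p)) \<partial>\<pi>))
       \<le> ennreal M * ennreal \<epsilon>1 + (ennreal L' * (\<Sum>e\<in>(Basis :: 'a set). ennreal (B' * \<epsilon>2)) + ennreal (L' * d / t) * ennreal \<eta>)"
      using slack unfolding s_def case_prod_beta
      by (intro add_mono mult_left_mono DK sum_mono qD) auto
    also have "(\<Sum>e\<in>(Basis :: 'a set). ennreal (B' * \<epsilon>2)) = ennreal (d * (B' * \<epsilon>2))"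
      using B' \<epsilon>12 by (subst sum_ennreal) (auto simp: d_def)
    also have "ennreal M * ennreal \<epsilon>1 + (ennreal L' * ennreal (d * (B' * \<epsilon>2)) + ennreal (L' * d / t) * ennreal \<eta>)
       = ennreal (M * \<epsilon>1 + (L' * (d * (B' * \<epsilon>2)) + L' * d / t * \<eta>))"
      using M L' B' d t \<eta> \<epsilon>12 by (simp add: ennreal_mult'[symmetric] ennreal_plus[symmetric] del: ennreal_plus)
    finally have "\<bar>(\<integral>x. u x \<partial>\<nu>) - (\<integral>y. v y \<partial>D)\<bar> \<le> M * \<epsilon>1 + (L' * (d * (B' * \<epsilon>2)) + L' * d / t * \<eta>)"
      by (subst (asm) ennreal_le_iff) (use M L' B' d t \<eta> \<epsilon>12 in auto)
    also have "\<dots> \<le> \<epsilon> / 3 + (\<epsilon> / 3 + \<epsilon> / 3)"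
    proof (intro add_mono)
      have "M * \<epsilon>1 = \<epsilon> / 3 * (M / (M + 1))" by (simp add: \<epsilon>1_def)
      also have "\<dots> \<le> \<epsilon> / 3 * 1" using \<epsilon> M by (intro mult_left_mono) auto
      finally show "M * \<epsilon>1 \<le> \<epsilon> / 3" by simp
      have "L' * (d * (B' * \<epsilon>2)) = \<epsilon> / 3 * ((L' / (L' + 1)) * (B' / (B' + 1)))"
        using d by (simp add: \<epsilon>2_def)
      also have "\<dots> \<le> \<epsilon> / 3 * (1 * 1)" using \<epsilon> L' B' by (intro mult_left_mono mult_mono) auto
      finally show "L' * (d * (B' * \<epsilon>2)) \<le> \<epsilon> / 3" by simp
      have "L' * d / t * \<eta> = \<epsilon> / 3 * (L' / (L' + 1))"
        using d t by (simp add: \<eta>_def)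
      also have "\<dots> \<le> \<epsilon> / 3 * 1" using \<epsilon> L' by (intro mult_left_mono) auto
      finally show "L' * d / t * \<eta> \<le> \<epsilon> / 3" by simp
    qed
    finally show "\<bar>(\<integral>x. u x \<partial>\<nu>) - (\<integral>y. v y \<partial>D)\<bar> \<le> \<epsilon>" by simp
  qed
qed

section \<open>Wasserstein costs and second moments\<close>

lemma W2sq_commute: "W2sq \<mu> \<nu> = W2sq \<nu> \<mu>"
proof -
  have "W2sq \<nu> \<mu> \<le> W2sq \<mu> \<nu>" for \<mu> \<nu> :: "'a::euclidean_space measure"
    unfolding W2sq_def[of \<mu>]
  proof (rule INF_greatest)
    fix \<pi> assume \<pi>: "\<pi> \<in> couplings \<mu> \<nu>"
    note c = couplingsD[OF \<pi>]
    interpret \<pi>: prob_space \<pi> using c(1) by (rule prob_measuresD)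
    have [simp, measurable_cong]: "sets \<pi> = sets borel" using c(1) by (rule prob_measuresD)
    have sw: "prod.swap \<in> measurable \<pi> borel"
    proof -
      have "(\<lambda>p. (snd p, fst p)) \<in> measurable \<pi> borel" using c(4,5) by measurable
      then show ?thesis by (simp add: prod.swap_def[abs_def])
    qed
    define \<pi>' where "\<pi>' = distr \<pi> borel prod.swap"
    have "\<pi>' \<in> couplings \<nu> \<mu>"
      using \<pi>.prob_space_distr[OF sw] c(2,3)
      by (auto simp: couplings_def prob_measures_def \<pi>'_def distr_distr sw comp_def)
    then have "W2sq \<nu> \<mu> \<le> (\<integral>\<^sup>+ (x, y). ennreal ((norm (x - y))\<^sup>2) \<partial>\<pi>')"
      unfolding W2sq_def by (rule INF_lower)
    also have "\<dots> = (\<integral>\<^sup>+ (x, y). ennreal ((norm (x - y))\<^sup>2) \<partial>\<pi>)"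
      unfolding \<pi>'_def case_prod_beta by (subst nn_integral_distr[OF sw]) (auto simp: norm_minus_commute)
    finally show "W2sq \<nu> \<mu> \<le> (\<integral>\<^sup>+ (x, y). ennreal ((norm (x - y))\<^sup>2) \<partial>\<pi>)" .
  qed
  then show ?thesis by (blast intro: antisym)
qed

lemma integrable_inner_L2:
  fixes f h :: "'a \<Rightarrow> 'b::euclidean_space"
  assumes [measurable]: "f \<in> borel_measurable M" "h \<in> borel_measurable M"
    and i: "integrable M (\<lambda>x. (norm (f x))\<^sup>2)" "integrable M (\<lambda>x. (norm (h x))\<^sup>2)"
  shows "integrable M (\<lambda>x. f x \<bullet> h x)"
proof (rule Bochner_Integration.integrable_bound)
  show "integrable M (\<lambda>x. (norm (f x))\<^sup>2 + (norm (h x))\<^sup>2)" using i by simp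
  show "AE x in M. norm (f x \<bullet> h x) \<le> norm ((norm (f x))\<^sup>2 + (norm (h x))\<^sup>2)"
  proof (rule AE_I2)
    fix x
    have "2 * (norm (f x) * norm (h x)) \<le> (norm (f x))\<^sup>2 + (norm (h x))\<^sup>2"
      using sum_squares_bound[of "norm (f x)" "norm (h x)"] by simp
    moreover have "0 \<le> norm (f x) * norm (h x)" by simp
    ultimately show "norm (f x \<bullet> h x) \<le> norm ((norm (f x))\<^sup>2 + (norm (h x))\<^sup>2)"
      using Cauchy_Schwarz_ineq2[of "f x" "h x"] by simp
  qed
qed measurable

lemma norm_diff_squared: "(norm (x - y))\<^sup>2 = (norm x)\<^sup>2 + (norm y)\<^sup>2 - 2 * (x \<bullet> y)"
  for x y :: "'a::real_inner"
  by (simp add: power2_norm_eq_inner inner_diff inner_commute)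

lemma integrable_norm_diff_L2:
  fixes f h :: "'a \<Rightarrow> 'b::euclidean_space"
  assumes "f \<in> borel_measurable M" "h \<in> borel_measurable M"
    and "integrable M (\<lambda>x. (norm (f x))\<^sup>2)" "integrable M (\<lambda>x. (norm (h x))\<^sup>2)"
  shows "integrable M (\<lambda>x. (norm (f x - h x))\<^sup>2)"
  unfolding norm_diff_squared using integrable_inner_L2[OF assms] assms by simp

text \<open>With the marginals fixed, the cost depends on the coupling only through the integral of
  the inner product, the term that Young's inequality controls.\<close>

lemma coupling_L2:
  fixes \<mu> \<nu> :: "'a::euclidean_space measure"
  assumes \<pi>: "\<pi> \<in> couplings \<mu> \<nu>" and m: "finite_second_moment \<mu>" "finite_second_moment \<nu>"
  shows "integrable \<pi> (\<lambda>p. fst p \<bullet> snd p)" "integrable \<pi> (\<lambda>p. (norm (fst p - snd p))\<^sup>2)"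
    and "(\<integral>p. (norm (fst p - snd p))\<^sup>2 \<partial>\<pi>) =
      (\<integral>x. (norm x)\<^sup>2 \<partial>\<mu>) + (\<integral>y. (norm y)\<^sup>2 \<partial>\<nu>) - 2 * (\<integral>p. fst p \<bullet> snd p \<partial>\<pi>)"
    and "(\<integral>\<^sup>+ (x, y). ennreal ((norm (x - y))\<^sup>2) \<partial>\<pi>) = ennreal (\<integral>p. (norm (fst p - snd p))\<^sup>2 \<partial>\<pi>)"
proof -
  note c = couplingsD[OF \<pi>]
  have i1: "integrable \<pi> (\<lambda>p. (norm (fst p))\<^sup>2)"
    using m(1) unfolding finite_second_moment_def c(2)[symmetric] by (subst (asm) integrable_distr_eq[OF c(4)]) auto
  have i2: "integrable \<pi> (\<lambda>p. (norm (snd p))\<^sup>2)"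
    using m(2) unfolding finite_second_moment_def c(3)[symmetric] by (subst (asm) integrable_distr_eq[OF c(5)]) auto
  show i: "integrable \<pi> (\<lambda>p. fst p \<bullet> snd p)" "integrable \<pi> (\<lambda>p. (norm (fst p - snd p))\<^sup>2)"
    by (rule integrable_inner_L2[OF c(4,5) i1 i2] integrable_norm_diff_L2[OF c(4,5) i1 i2])+
  have "(\<integral>x. (norm x)\<^sup>2 \<partial>\<mu>) = (\<integral>p. (norm (fst p))\<^sup>2 \<partial>\<pi>)"
    unfolding c(2)[symmetric] by (rule integral_distr[OF c(4)]) simp
  moreover have "(\<integral>y. (norm y)\<^sup>2 \<partial>\<nu>) = (\<integral>p. (norm (snd p))\<^sup>2 \<partial>\<pi>)"
    unfolding c(3)[symmetric] by (rule integral_distr[OF c(5)]) simp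
  ultimately show "(\<integral>p. (norm (fst p - snd p))\<^sup>2 \<partial>\<pi>) =
      (\<integral>x. (norm x)\<^sup>2 \<partial>\<mu>) + (\<integral>y. (norm y)\<^sup>2 \<partial>\<nu>) - 2 * (\<integral>p. fst p \<bullet> snd p \<partial>\<pi>)"
    unfolding norm_diff_squared using i1 i2 i(1) by simp
  show "(\<integral>\<^sup>+ (x, y). ennreal ((norm (x - y))\<^sup>2) \<partial>\<pi>) = ennreal (\<integral>p. (norm (fst p - snd p))\<^sup>2 \<partial>\<pi>)"
    unfolding case_prod_beta using i(2) by (rule nn_integral_eq_integral) simp
qed

lemma couplings_nonempty:
  fixes \<mu> \<nu> :: "'a::euclidean_space measure"
  assumes "\<mu> \<in> prob_measures" "\<nu> \<in> prob_measures"
  shows "\<mu> \<Otimes>\<^sub>M \<nu> \<in> couplings \<mu> \<nu>"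
proof -
  interpret \<mu>: prob_space \<mu> using assms(1) by (rule prob_measuresD)
  interpret \<nu>: prob_space \<nu> using assms(2) by (rule prob_measuresD)
  interpret pair_prob_space \<mu> \<nu> ..
  have s: "sets \<mu> = sets borel" "sets \<nu> = sets borel" using assms by (auto dest: prob_measuresD)
  have sp: "sets (\<mu> \<Otimes>\<^sub>M \<nu>) = sets borel"
    unfolding borel_prod[symmetric] by (rule sets_pair_measure_cong[OF s])
  have "distr (\<mu> \<Otimes>\<^sub>M \<nu>) borel fst = distr (\<mu> \<Otimes>\<^sub>M \<nu>) \<mu> fst"
    by (rule distr_cong) (simp_all add: s)
  also have "\<dots> = \<mu>" by (rule \<nu>.distr_pair_fst)
  finally have 1: "distr (\<mu> \<Otimes>\<^sub>M \<nu>) borel fst = \<mu>" .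
  have "distr (\<mu> \<Otimes>\<^sub>M \<nu>) borel snd = \<nu>"
  proof (rule measure_eqI)
    fix A assume "A \<in> sets (distr (\<mu> \<Otimes>\<^sub>M \<nu>) borel snd)"
    then have A: "A \<in> sets borel" by simp
    have "snd -` A \<inter> space (\<mu> \<Otimes>\<^sub>M \<nu>) = space \<mu> \<times> A"
      using A s sets.sets_into_space[of A \<nu>] by (auto simp: space_pair_measure)
    moreover have "emeasure (\<mu> \<Otimes>\<^sub>M \<nu>) (space \<mu> \<times> A) = emeasure \<mu> (space \<mu>) * emeasure \<nu> A"
      by (rule \<nu>.emeasure_pair_measure_Times) (use A s in auto)
    ultimately show "emeasure (distr (\<mu> \<Otimes>\<^sub>M \<nu>) borel snd) A = emeasure \<nu> A"
      using A by (subst emeasure_distr) (auto simp: \<mu>.emeasure_space_1 sp cong: measurable_cong_sets)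
  qed (simp add: s)
  with 1 show ?thesis
    using prob_space_axioms by (simp add: couplings_def prob_measures_def sp)
qed

lemma W2sq_finite:
  fixes \<mu> \<nu> :: "'a::euclidean_space measure"
  assumes "\<mu> \<in> prob_measures" "\<nu> \<in> prob_measures" "finite_second_moment \<mu>" "finite_second_moment \<nu>"
  shows "W2sq \<mu> \<nu> < \<infinity>"
proof -
  have "W2sq \<mu> \<nu> \<le> (\<integral>\<^sup>+ (x, y). ennreal ((norm (x - y))\<^sup>2) \<partial>(\<mu> \<Otimes>\<^sub>M \<nu>))"
    unfolding W2sq_def by (rule INF_lower[OF couplings_nonempty[OF assms(1,2)]])
  also have "\<dots> < \<infinity>"
    by (subst coupling_L2(4)[OF couplings_nonempty[OF assms(1,2)] assms(3,4)]) simp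
  finally show ?thesis .
qed

text \<open>Under a coupling of finite cost, \<open>y = x - (x - y)\<close> is a difference of two
  square-integrable functions. This supplies the moment bound for competitors in
  \<open>Bary\<close>, which range over all probability measures.\<close>

lemma finite_second_moment_of_W2sq:
  fixes \<mu> \<nu> :: "'a::euclidean_space measure"
  assumes "finite_second_moment \<mu>" "W2sq \<mu> \<nu> < \<infinity>"
  shows "finite_second_moment \<nu>"
proof -
  obtain \<pi> where \<pi>: "\<pi> \<in> couplings \<mu> \<nu>" and fin: "(\<integral>\<^sup>+ (x, y). ennreal ((norm (x - y))\<^sup>2) \<partial>\<pi>) < \<infinity>"
    using assms(2) unfolding W2sq_def INF_less_iff by blast
  note c = couplingsD[OF \<pi>]
  note [measurable] = c(4,5)
  have i1: "integrable \<pi> (\<lambda>p. (norm (fst p))\<^sup>2)"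
    using assms(1) unfolding finite_second_moment_def c(2)[symmetric]
    by (subst (asm) integrable_distr_eq[OF c(4)]) auto
  have i2: "integrable \<pi> (\<lambda>p. (norm (fst p - snd p))\<^sup>2)"
    using fin unfolding case_prod_beta by (intro integrableI_bounded) auto
  have "integrable \<pi> (\<lambda>p. (norm (fst p - (fst p - snd p)))\<^sup>2)"
    by (rule integrable_norm_diff_L2[OF _ _ i1 i2]) measurable
  then have "integrable \<pi> (\<lambda>p. (norm (snd p))\<^sup>2)" by simp
  then show ?thesis
    unfolding finite_second_moment_def c(3)[symmetric] by (subst integrable_distr_eq[OF c(5)]) auto
qed

text \<open>The cost is stated with \<open>\<nu>\<close> first, matching the barycenter functional;
  this is where symmetry of \<open>W2sq\<close> enters.\<close>

lemma optimal_transport_mapD: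
  fixes \<mu> \<nu> :: "'a::euclidean_space measure"
  assumes T: "optimal_transport_map \<mu> \<nu> T" and \<mu>: "\<mu> \<in> prob_measures"
    and m: "finite_second_moment \<mu>" "finite_second_moment \<nu>"
  shows "T \<in> borel_measurable \<mu>" "distr \<mu> borel T = \<nu>"
    "integrable \<mu> (\<lambda>x. (norm (T x))\<^sup>2)" "integrable \<mu> (\<lambda>x. (norm (T x - x))\<^sup>2)"
    "integrable \<mu> (\<lambda>x. T x \<bullet> x)"
    "W2sq \<nu> \<mu> = ennreal (\<integral>x. (norm (T x - x))\<^sup>2 \<partial>\<mu>)"
proof -
  show Tm: "T \<in> borel_measurable \<mu>" and d: "distr \<mu> borel T = \<nu>"
    using T by (auto simp: optimal_transport_map_def)
  have [measurable_cong]: "sets \<mu> = sets borel" using \<mu> by (rule prob_measuresD)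
  have id: "(\<lambda>x. x) \<in> borel_measurable \<mu>" by measurable
  show i: "integrable \<mu> (\<lambda>x. (norm (T x))\<^sup>2)"
    using m(2) unfolding finite_second_moment_def d[symmetric]
    by (subst (asm) integrable_distr_eq[OF Tm]) auto
  show "integrable \<mu> (\<lambda>x. T x \<bullet> x)" and i2: "integrable \<mu> (\<lambda>x. (norm (T x - x))\<^sup>2)"
    using m(1) unfolding finite_second_moment_def
    by (rule integrable_inner_L2[OF Tm id i] integrable_norm_diff_L2[OF Tm id i])+
  have "W2sq \<mu> \<nu> = (\<integral>\<^sup>+ x. ennreal ((norm (T x - x))\<^sup>2) \<partial>\<mu>)"
    using T by (simp add: optimal_transport_map_def)
  also have "\<dots> = ennreal (\<integral>x. (norm (T x - x))\<^sup>2 \<partial>\<mu>)"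
    using i2 by (rule nn_integral_eq_integral) simp
  finally show "W2sq \<nu> \<mu> = ennreal (\<integral>x. (norm (T x - x))\<^sup>2 \<partial>\<mu>)" by (simp add: W2sq_commute)
qed

text \<open>The complement of the closure is open and null for the image measure, so it misses the
  support. With the identity it gives density of \<open>N\<close>, with a transport map density of
  the image of \<open>N\<close>.\<close>

lemma measure_support_distr_dense:
  assumes f: "f \<in> borel_measurable M" and N: "AE x in M. x \<in> N"
    and supp: "\<Omega> \<subseteq> measure_support (distr M borel f)"
  shows "\<Omega> \<subseteq> closure (f ` N)"
proof
  fix y assume y: "y \<in> \<Omega>"
  show "y \<in> closure (f ` N)"
  proof (rule ccontr)
    assume "y \<notin> closure (f ` N)"
    moreover have "open (- closure (f ` N))" by (intro open_Compl closed_closure)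
    ultimately have "emeasure (distr M borel f) (- closure (f ` N)) > 0"
      using y supp unfolding measure_support_def by blast
    moreover have "emeasure (distr M borel f) (- closure (f ` N)) = emeasure M (f -` (- closure (f ` N)) \<inter> space M)"
      by (rule emeasure_distr[OF f]) auto
    moreover have "AE x in M. x \<notin> f -` (- closure (f ` N)) \<inter> space M"
      using N by eventually_elim (use closure_subset[of "f ` N"] in auto)
    then have "emeasure M (f -` (- closure (f ` N)) \<inter> space M) = 0"
      by (subst (asm) AE_iff_measurable[OF measurable_sets[OF f, of "- closure (f ` N)"]]) auto
    ultimately show False by simp
  qed
qed

section \<open>Barycenters\<close>

text \<open>The potentials act as a dual certificate: integrating the bound on the averaged
  potential against \<open>\<nu>\<close>, with equality against \<open>\<mu>\<close>, leaves exactly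
  the slack as surplus. Keeping the slack in the inequality lets it serve for uniqueness as well as
  minimality. The weights stand inside the integrals because integrability is established only for
  \<open>l j * \<phi> j\<close>.\<close>

lemma barycenter_lower_bound:
  fixes \<mu> :: "'a::euclidean_space measure" and D :: "'m::finite \<Rightarrow> 'a measure" and l :: "'m \<Rightarrow> real"
  assumes prob: "\<mu> \<in> prob_measures" "\<And>j. D j \<in> prob_measures"
    and mom: "finite_second_moment \<mu>" "\<And>j. finite_second_moment (D j)"
    and \<Omega>: "open \<Omega>" "convex \<Omega>" "\<Omega> = UNIV \<or> bounded \<Omega>"
    and supp: "supported_on \<mu> \<Omega>" "\<And>j. supported_on (D j) \<Omega>"
    and T: "\<And>j. optimal_transport_map \<mu> (D j) (T j)"
    and l: "\<And>j. 0 \<le> l j" "(\<Sum>j\<in>UNIV. l j) = 1"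
    and avg: "AE x in \<mu>. (\<Sum>j\<in>UNIV. l j *\<^sub>R T j x) = x"
  obtains \<phi> \<psi> :: "'m \<Rightarrow> 'a \<Rightarrow> real" where
    "\<And>j. convex_on \<Omega> (\<psi> j)" "\<And>j. \<psi> j \<in> borel_measurable borel" "\<And>j. \<phi> j \<in> borel_measurable borel"
    "\<And>j y z. y \<in> \<Omega> \<Longrightarrow> y \<bullet> z \<le> \<phi> j z + \<psi> j y"
    "\<And>\<nu> \<pi> j. finite_second_moment \<nu> \<Longrightarrow> \<nu> \<in> prob_measures \<Longrightarrow> \<pi> \<in> couplings (D j) \<nu> \<Longrightarrow>
       integrable \<pi> (\<lambda>p. l j * (\<phi> j (snd p) + \<psi> j (fst p) - fst p \<bullet> snd p))"
    "\<And>\<nu> \<pi>. finite_second_moment \<nu> \<Longrightarrow> \<nu> \<in> prob_measures \<Longrightarrow> (\<And>j. \<pi> j \<in> couplings (D j) \<nu>) \<Longrightarrow>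
       (\<Sum>j\<in>UNIV. l j * (\<integral>x. (norm (T j x - x))\<^sup>2 \<partial>\<mu>))
         + 2 * (\<Sum>j\<in>UNIV. \<integral>p. l j * (\<phi> j (snd p) + \<psi> j (fst p) - fst p \<bullet> snd p) \<partial>(\<pi> j))
       \<le> (\<Sum>j\<in>UNIV. l j * (\<integral>p. (norm (fst p - snd p))\<^sup>2 \<partial>(\<pi> j)))"
proof -
  interpret \<mu>: prob_space \<mu> using prob(1) by (rule prob_measuresD)
  have [simp, measurable_cong]: "sets \<mu> = sets borel" using prob(1) by (rule prob_measuresD)
  note TD = optimal_transport_mapD[OF T prob(1) mom]
  note [measurable] = TD(1)
  have "\<exists>N. (AE x in \<mu>. x \<in> N) \<and> cyclically_monotone_on N (T j)" for j
    by (rule optimal_transport_map_cyclic[OF prob(1) W2sq_finite[OF prob mom] T])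
  then obtain N0 where N0: "\<And>j. AE x in \<mu>. x \<in> N0 j" "\<And>j. cyclically_monotone_on (N0 j) (T j)"
    by metis
  \<comment> \<open>One set of full measure on which everything holds for all indices at
    once.\<close>
  define N where "N = {x\<in>\<Omega>. (\<forall>j. x \<in> N0 j \<and> T j x \<in> \<Omega>) \<and> (\<Sum>j\<in>UNIV. l j *\<^sub>R T j x) = x}"
  have T\<Omega>: "AE x in \<mu>. T j x \<in> \<Omega>" for j
  proof -
    have "AE y in distr \<mu> borel (T j). y \<in> \<Omega>"
      using supp(2)[of j] unfolding TD(2) by (simp add: supported_on_def)
    then show ?thesis by (rule AE_distrD[OF TD(1)])
  qed
  have "AE x in \<mu>. \<forall>j. x \<in> N0 j \<and> T j x \<in> \<Omega>"
    using N0(1) T\<Omega> by (intro eventually_all_finite) auto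
  moreover have "AE x in \<mu>. x \<in> \<Omega>" using supp(1) by (simp add: supported_on_def)
  ultimately have AEN: "AE x in \<mu>. x \<in> N"
    using avg unfolding N_def by eventually_elim auto
  have N\<Omega>: "N \<subseteq> \<Omega>" by (auto simp: N_def)
  have cm: "cyclically_monotone_on N (T j)" for j
    by (rule cyclically_monotone_on_subset[OF N0(2)]) (auto simp: N_def)
  have "\<Omega> \<subseteq> closure ((\<lambda>x. x) ` N)"
  proof (rule measure_support_distr_dense[OF _ AEN])
    show "(\<lambda>x. x) \<in> borel_measurable \<mu>" by measurable
    have "distr \<mu> borel (\<lambda>x. x) = \<mu>" by (rule distr_id2) simp
    then show "\<Omega> \<subseteq> measure_support (distr \<mu> borel (\<lambda>x. x))"
      using supp(1) by (simp add: supported_on_def)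
  qed
  then have dense: "\<Omega> \<subseteq> closure N" by simp
  have denseT: "\<Omega> \<subseteq> closure (T j ` N)" for j
    using supp(2)[of j] by (intro measure_support_distr_dense[OF TD(1) AEN]) (simp add: TD(2) supported_on_def)
  have "\<not> (AE x in \<mu>. False)" by (simp add: \<mu>.AE_False)
  then have Nne: "N \<noteq> {}" using AEN by auto
  then have \<Omega>ne: "\<Omega> \<noteq> {}" using N\<Omega> by auto
  have hull: "convex hull N = UNIV \<or> bounded (T j ` N)" for j
    using \<Omega>(3)
  proof
    assume "\<Omega> = UNIV" then show ?thesis using subset_convex_hull_dense[OF \<Omega>(1) dense] by auto
  next
    assume "bounded \<Omega>"
    then have "bounded (T j ` N)" by (rule bounded_subset) (auto simp: N_def)
    then show ?thesis ..
  qed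
  \<comment> \<open>Bundles the properties of both potentials, so that one choice over
    \<open>j\<close> yields the two families.\<close>
  define R where "R j \<phi> \<psi> \<longleftrightarrow> convex_on UNIV \<phi> \<and> (\<forall>x\<in>N. \<forall>z. \<phi> x + T j x \<bullet> (z - x) \<le> \<phi> z)
      \<and> (\<forall>w z b. (\<forall>x\<in>N. T j x \<bullet> (z - w) \<le> b) \<longrightarrow> \<phi> z \<le> \<phi> w + b)
      \<and> convex_on \<Omega> \<psi> \<and> (\<forall>y\<in>\<Omega>. \<forall>z. y \<bullet> z \<le> \<phi> z + \<psi> y) \<and> (\<forall>x\<in>N. \<psi> (T j x) = T j x \<bullet> x - \<phi> x)"
    for j \<phi> \<psi>
  have "\<exists>\<phi> \<psi>. R j \<phi> \<psi>" for j
  proof (rule cyclically_monotone_potential[OF cm[of j] Nne hull])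
    fix \<phi> assume \<phi>: "convex_on UNIV \<phi>"
      "\<And>x z. x \<in> N \<Longrightarrow> \<phi> x + T j x \<bullet> (z - x) \<le> \<phi> z"
      "\<And>w z b. (\<And>x. x \<in> N \<Longrightarrow> T j x \<bullet> (z - w) \<le> b) \<Longrightarrow> \<phi> z \<le> \<phi> w + b"
    show ?thesis
    proof (rule conjugate_potential[OF \<phi>(2) subset_convex_hull_dense[OF \<Omega>(1) denseT[of j]] \<Omega>(2)])
      fix \<psi> assume \<psi>: "convex_on \<Omega> \<psi>" "\<And>y z. y \<in> \<Omega> \<Longrightarrow> y \<bullet> z \<le> \<phi> z + \<psi> y"
        "\<And>x. x \<in> N \<Longrightarrow> \<psi> (T j x) = T j x \<bullet> x - \<phi> x"
      have "R j \<phi> \<psi>"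
        unfolding R_def by (intro conjI ballI allI impI \<phi> \<psi>) auto
      then show ?thesis by blast
    qed
  qed
  then obtain \<phi> \<psi>0 where R: "\<And>j. R j (\<phi> j) (\<psi>0 j)" by metis
  have \<phi>: "\<And>j. convex_on UNIV (\<phi> j)"
      "\<And>j x z. x \<in> N \<Longrightarrow> \<phi> j x + T j x \<bullet> (z - x) \<le> \<phi> j z"
      "\<And>j w z b. (\<And>x. x \<in> N \<Longrightarrow> T j x \<bullet> (z - w) \<le> b) \<Longrightarrow> \<phi> j z \<le> \<phi> j w + b"
    and \<psi>0: "\<And>j. convex_on \<Omega> (\<psi>0 j)" "\<And>j y z. y \<in> \<Omega> \<Longrightarrow> y \<bullet> z \<le> \<phi> j z + \<psi>0 j y"
      "\<And>j x. x \<in> N \<Longrightarrow> \<psi>0 j (T j x) = T j x \<bullet> x - \<phi> j x"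
    using R unfolding R_def by simp_all
  \<comment> \<open>Extension by 0 makes the conjugate Borel on the whole space; convexity and
    Young's inequality are claimed on \<open>\<Omega>\<close> only.\<close>
  define \<psi> where "\<psi> j y = indicator \<Omega> y *\<^sub>R \<psi>0 j y" for j y
  have [measurable]: "\<Omega> \<in> sets borel" using \<Omega>(1) by simp
  have \<phi>m[measurable]: "\<phi> j \<in> borel_measurable borel" for j
    using convex_on_continuous[OF open_UNIV \<phi>(1)] by (rule borel_measurable_continuous_onI)
  have \<psi>m[measurable]: "\<psi> j \<in> borel_measurable borel" for j
    unfolding \<psi>_def using \<Omega>(1) convex_on_continuous[OF \<Omega>(1) \<psi>0(1)]
    by (intro borel_measurable_continuous_on_indicator) auto
  have \<psi>_cvx: "convex_on \<Omega> (\<psi> j)" for j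
    using \<psi>0(1)[of j] \<Omega>(2) unfolding convex_on_def \<psi>_def convex_def by auto
  have young: "y \<bullet> z \<le> \<phi> j z + \<psi> j y" if "y \<in> \<Omega>" for j y z
    using \<psi>0(2)[OF that] that by (simp add: \<psi>_def)
  have \<psi>T: "\<psi> j (T j x) = T j x \<bullet> x - \<phi> j x" if "x \<in> N" for j x
    using \<psi>0(3)[OF that] that by (simp add: \<psi>_def N_def)
  have range: "\<Omega> = UNIV \<or> (\<forall>j. \<forall>x\<in>N. T j x \<in> \<Omega>)" by (auto simp: N_def)
  obtain C where C: "\<And>x. x \<in> \<Omega> \<Longrightarrow> (\<Sum>j\<in>UNIV. l j * \<phi> j x) = (norm x)\<^sup>2 / 2 + C"
    "\<And>z. (\<Sum>j\<in>UNIV. l j * \<phi> j z) \<le> (norm z)\<^sup>2 / 2 + C"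
    by (rule average_potential[of l \<phi> N T \<Omega>, OF l \<phi> _ \<Omega>(2) \<Omega>ne dense range]) (auto simp: N_def)
  obtain a where a: "a \<in> N" using Nne by blast
  \<comment> \<open>Each \<open>l j * \<phi> j\<close> lies between an affine function and a function of quadratic growth, hence is integrable.\<close>
  define aff where "aff j z = \<phi> j a + T j a \<bullet> (z - a)" for j z
  define H where "H z = (norm z)\<^sup>2 / 2 + C - (\<Sum>i\<in>UNIV. l i * aff i z)" for z
  have aff: "aff j z \<le> \<phi> j z" for j z unfolding aff_def by (rule \<phi>(2)[OF a])
  have H: "l j * (\<phi> j z - aff j z) \<le> H z" "0 \<le> l j * (\<phi> j z - aff j z)" for j z
  proof -
    have nn: "0 \<le> l i * (\<phi> i z - aff i z)" for i using l(1)[of i] aff[of i z] by simp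
    then show "0 \<le> l j * (\<phi> j z - aff j z)" .
    have "l j * (\<phi> j z - aff j z) \<le> (\<Sum>i\<in>UNIV. l i * (\<phi> i z - aff i z))"
      using nn by (intro member_le_sum) auto
    also have "\<dots> = (\<Sum>i\<in>UNIV. l i * \<phi> i z) - (\<Sum>i\<in>UNIV. l i * aff i z)"
      by (simp add: right_diff_distrib sum_subtractf)
    also have "\<dots> \<le> H z" using C(2)[of z] by (simp add: H_def)
    finally show "l j * (\<phi> j z - aff j z) \<le> H z" .
  qed
  have int\<phi>: "integrable \<nu> (\<lambda>z. l j * \<phi> j z)"
    if \<nu>: "\<nu> \<in> prob_measures" "finite_second_moment \<nu>" for \<nu> j
  proof -
    interpret \<nu>: prob_space \<nu> using \<nu>(1) by (rule prob_measuresD)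
    have [simp, measurable_cong]: "sets \<nu> = sets borel" using \<nu>(1) by (rule prob_measuresD)
    have sq: "integrable \<nu> (\<lambda>z. (norm z)\<^sup>2)" using \<nu>(2) by (simp add: finite_second_moment_def)
    have "integrable \<nu> (\<lambda>z. T i a \<bullet> z)" for i
      by (rule integrable_inner_L2) (use sq in auto)
    then have affi: "integrable \<nu> (aff i)" for i
      unfolding aff_def inner_diff_right by simp
    then have "integrable \<nu> H" unfolding H_def using sq by simp
    then have "integrable \<nu> (\<lambda>z. l j * (\<phi> j z - aff j z))"
    proof (rule Bochner_Integration.integrable_bound)
      show "AE z in \<nu>. norm (l j * (\<phi> j z - aff j z)) \<le> norm (H z)"
        using H[of j] by (intro AE_I2) (metis abs_of_nonneg order_trans real_norm_def)
    qed (simp add: aff_def)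
    then have "integrable \<nu> (\<lambda>z. l j * (\<phi> j z - aff j z) + l j * aff j z)"
      using affi by (intro Bochner_Integration.integrable_add) auto
    then show ?thesis by (simp add: algebra_simps)
  qed
  \<comment> \<open>Equality in Young's inequality along the graph of \<open>T j\<close> expresses
    the conjugate through integrable functions, giving its integrability and integral under
    \<open>D j\<close>.\<close>
  have \<psi>_AE: "AE x in \<mu>. l j * \<psi> j (T j x) = l j * (T j x \<bullet> x) - l j * \<phi> j x" for j
    using AEN by eventually_elim (simp add: \<psi>T algebra_simps)
  have i\<psi>\<mu>: "integrable \<mu> (\<lambda>x. l j * (T j x \<bullet> x) - l j * \<phi> j x)" for j
    using TD(5) int\<phi>[OF prob(1) mom(1)] by simp
  have int\<psi>: "integrable (D j) (\<lambda>y. l j * \<psi> j y)" for j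
    unfolding TD(2)[symmetric]
    by (subst integrable_distr_eq[OF TD(1)], measurable) (subst integrable_cong_AE[OF _ _ \<psi>_AE], auto simp: i\<psi>\<mu>)
  have I\<psi>: "(\<integral>y. l j * \<psi> j y \<partial>(D j)) = l j * (\<integral>x. T j x \<bullet> x \<partial>\<mu>) - (\<integral>x. l j * \<phi> j x \<partial>\<mu>)" for j
  proof -
    have "(\<integral>y. l j * \<psi> j y \<partial>(D j)) = (\<integral>x. l j * \<psi> j (T j x) \<partial>\<mu>)"
      unfolding TD(2)[symmetric] by (rule integral_distr[OF TD(1)]) measurable
    also have "\<dots> = (\<integral>x. l j * (T j x \<bullet> x) - l j * \<phi> j x \<partial>\<mu>)"
      by (rule integral_cong_AE[OF _ _ \<psi>_AE]) auto
    also have "\<dots> = l j * (\<integral>x. T j x \<bullet> x \<partial>\<mu>) - (\<integral>x. l j * \<phi> j x \<partial>\<mu>)"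
      using TD(5) int\<phi>[OF prob(1) mom(1)] by simp
    finally show ?thesis .
  qed
  have split: "integrable \<pi> (\<lambda>p. l j * (\<phi> j (snd p) + \<psi> j (fst p) - fst p \<bullet> snd p))"
    "(\<integral>p. l j * (\<phi> j (snd p) + \<psi> j (fst p) - fst p \<bullet> snd p) \<partial>\<pi>) =
      (\<integral>z. l j * \<phi> j z \<partial>\<nu>) + (\<integral>y. l j * \<psi> j y \<partial>(D j)) - l j * (\<integral>p. fst p \<bullet> snd p \<partial>\<pi>)"
    if \<nu>: "finite_second_moment \<nu>" "\<nu> \<in> prob_measures" and \<pi>: "\<pi> \<in> couplings (D j) \<nu>" for \<nu> \<pi> j
  proof -
    note c = couplingsD[OF \<pi>]
    have i1: "integrable \<pi> (\<lambda>p. l j * \<phi> j (snd p))"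
      using int\<phi>[OF \<nu>(2,1), of j] unfolding c(3)[symmetric]
      by (subst (asm) integrable_distr_eq[OF c(5)]) auto
    have i2: "integrable \<pi> (\<lambda>p. l j * \<psi> j (fst p))"
      using int\<psi>[of j] unfolding c(2)[symmetric]
      by (subst (asm) integrable_distr_eq[OF c(4)]) auto
    have i3: "integrable \<pi> (\<lambda>p. l j * (fst p \<bullet> snd p))"
      using coupling_L2(1)[OF \<pi> mom(2) \<nu>(1)] by simp
    have e1: "(\<integral>z. l j * \<phi> j z \<partial>\<nu>) = (\<integral>p. l j * \<phi> j (snd p) \<partial>\<pi>)"
      unfolding c(3)[symmetric] by (rule integral_distr[OF c(5)]) measurable
    have e2: "(\<integral>y. l j * \<psi> j y \<partial>(D j)) = (\<integral>p. l j * \<psi> j (fst p) \<partial>\<pi>)"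
      unfolding c(2)[symmetric] by (rule integral_distr[OF c(4)]) measurable
    have eq: "(\<lambda>p. l j * (\<phi> j (snd p) + \<psi> j (fst p) - fst p \<bullet> snd p))
      = (\<lambda>p. l j * \<phi> j (snd p) + l j * \<psi> j (fst p) - l j * (fst p \<bullet> snd p))"
      by (simp add: algebra_simps)
    show "integrable \<pi> (\<lambda>p. l j * (\<phi> j (snd p) + \<psi> j (fst p) - fst p \<bullet> snd p))"
      unfolding eq using i1 i2 i3 by simp
    show "(\<integral>p. l j * (\<phi> j (snd p) + \<psi> j (fst p) - fst p \<bullet> snd p) \<partial>\<pi>) =
      (\<integral>z. l j * \<phi> j z \<partial>\<nu>) + (\<integral>y. l j * \<psi> j y \<partial>(D j)) - l j * (\<integral>p. fst p \<bullet> snd p \<partial>\<pi>)"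
      unfolding eq e1 e2 using i1 i2 i3 by simp
  qed
  show thesis
  proof (rule that[OF \<psi>_cvx \<psi>m \<phi>m young split(1)])
    fix \<nu> \<pi> assume \<nu>: "finite_second_moment \<nu>" "\<nu> \<in> prob_measures" and \<pi>: "\<And>j. \<pi> j \<in> couplings (D j) \<nu>"
    interpret \<nu>: prob_space \<nu> using \<nu>(2) by (rule prob_measuresD)
    have sq\<nu>: "integrable \<nu> (\<lambda>z. (norm z)\<^sup>2)" and sq\<mu>: "integrable \<mu> (\<lambda>z. (norm z)\<^sup>2)"
      using \<nu>(1) mom(1) by (simp_all add: finite_second_moment_def)
    define m where "m j = (\<integral>x. (norm (T j x))\<^sup>2 \<partial>\<mu>)" for j
    have m_eq: "(\<integral>y. (norm y)\<^sup>2 \<partial>(D j)) = m j" for j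
      unfolding m_def TD(2)[symmetric] by (rule integral_distr[OF TD(1)]) simp
    have F\<nu>: "(\<Sum>j\<in>UNIV. \<integral>z. l j * \<phi> j z \<partial>\<nu>) \<le> (\<integral>z. (norm z)\<^sup>2 \<partial>\<nu>) / 2 + C"
    proof -
      have "(\<Sum>j\<in>UNIV. \<integral>z. l j * \<phi> j z \<partial>\<nu>) = (\<integral>z. (\<Sum>j\<in>UNIV. l j * \<phi> j z) \<partial>\<nu>)"
        using int\<phi>[OF \<nu>(2,1)] by (intro Bochner_Integration.integral_sum[symmetric]) auto
      also have "\<dots> \<le> (\<integral>z. (norm z)\<^sup>2 / 2 + C \<partial>\<nu>)"
        using int\<phi>[OF \<nu>(2,1)] sq\<nu> C(2) by (intro integral_mono) auto
      also have "\<dots> = (\<integral>z. (norm z)\<^sup>2 \<partial>\<nu>) / 2 + C"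
        using sq\<nu> by (simp add: \<nu>.prob_space)
      finally show ?thesis .
    qed
    have F\<mu>: "(\<Sum>j\<in>UNIV. \<integral>z. l j * \<phi> j z \<partial>\<mu>) = (\<integral>z. (norm z)\<^sup>2 \<partial>\<mu>) / 2 + C"
    proof -
      have "(\<Sum>j\<in>UNIV. \<integral>z. l j * \<phi> j z \<partial>\<mu>) = (\<integral>z. (\<Sum>j\<in>UNIV. l j * \<phi> j z) \<partial>\<mu>)"
        using int\<phi>[OF prob(1) mom(1)] by (intro Bochner_Integration.integral_sum[symmetric]) auto
      also have "\<dots> = (\<integral>z. (norm z)\<^sup>2 / 2 + C \<partial>\<mu>)"
        using AEN by (intro integral_cong_AE) (auto elim!: eventually_mono intro!: C(1) simp: N_def)
      also have "\<dots> = (\<integral>z. (norm z)\<^sup>2 \<partial>\<mu>) / 2 + C"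
        using sq\<mu> by (simp add: \<mu>.prob_space)
      finally show ?thesis .
    qed
    have V: "(\<integral>x. (norm (T j x - x))\<^sup>2 \<partial>\<mu>) = m j + (\<integral>x. (norm x)\<^sup>2 \<partial>\<mu>) - 2 * (\<integral>x. T j x \<bullet> x \<partial>\<mu>)" for j
      unfolding m_def norm_diff_squared using TD(3,5) sq\<mu> by simp
    \<comment> \<open>The inner products under \<open>\<pi> j\<close> cancel between cost and slack;
      what remains depends on \<open>\<nu>\<close> only through its second moment and the integrals
      of the potentials.\<close>
    have "(\<Sum>j\<in>UNIV. l j * (\<integral>p. (norm (fst p - snd p))\<^sup>2 \<partial>(\<pi> j)))
        - 2 * (\<Sum>j\<in>UNIV. \<integral>p. l j * (\<phi> j (snd p) + \<psi> j (fst p) - fst p \<bullet> snd p) \<partial>(\<pi> j))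
      = (\<Sum>j\<in>UNIV. l j * m j + l j * (\<integral>z. (norm z)\<^sup>2 \<partial>\<nu>) - 2 * (\<integral>z. l j * \<phi> j z \<partial>\<nu>)
          - 2 * (l j * (\<integral>x. T j x \<bullet> x \<partial>\<mu>)) + 2 * (\<integral>x. l j * \<phi> j x \<partial>\<mu>))"
      unfolding sum_distrib_left[of 2] sum_subtractf[symmetric]
      by (intro sum.cong refl)
        (simp only: coupling_L2(3)[OF \<pi> mom(2) \<nu>(1)] split(2)[OF \<nu> \<pi>] m_eq I\<psi>, simp add: algebra_simps)
    also have "\<dots> = (\<Sum>j\<in>UNIV. l j * m j) + (\<integral>z. (norm z)\<^sup>2 \<partial>\<nu>) - 2 * (\<Sum>j\<in>UNIV. \<integral>z. l j * \<phi> j z \<partial>\<nu>)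
          - 2 * (\<Sum>j\<in>UNIV. l j * (\<integral>x. T j x \<bullet> x \<partial>\<mu>)) + 2 * (\<Sum>j\<in>UNIV. \<integral>x. l j * \<phi> j x \<partial>\<mu>)"
      by (simp add: sum.distrib sum_subtractf sum_distrib_left sum_distrib_right[symmetric] l(2))
    also have "\<dots> \<ge> (\<Sum>j\<in>UNIV. l j * m j) + (\<integral>z. (norm z)\<^sup>2 \<partial>\<mu>) - 2 * (\<Sum>j\<in>UNIV. l j * (\<integral>x. T j x \<bullet> x \<partial>\<mu>))"
      using F\<nu> F\<mu> by simp
    also have "(\<Sum>j\<in>UNIV. l j * m j) + (\<integral>z. (norm z)\<^sup>2 \<partial>\<mu>) - 2 * (\<Sum>j\<in>UNIV. l j * (\<integral>x. T j x \<bullet> x \<partial>\<mu>))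
      = (\<Sum>j\<in>UNIV. l j * (\<integral>x. (norm (T j x - x))\<^sup>2 \<partial>\<mu>))"
      unfolding V
      by (simp add: ring_distribs sum.distrib sum_subtractf sum_distrib_right[symmetric] l(2) sum_distrib_left mult.left_commute)
    finally show "(\<Sum>j\<in>UNIV. l j * (\<integral>x. (norm (T j x - x))\<^sup>2 \<partial>\<mu>))
         + 2 * (\<Sum>j\<in>UNIV. \<integral>p. l j * (\<phi> j (snd p) + \<psi> j (fst p) - fst p \<bullet> snd p) \<partial>(\<pi> j))
       \<le> (\<Sum>j\<in>UNIV. l j * (\<integral>p. (norm (fst p - snd p))\<^sup>2 \<partial>(\<pi> j)))" by simp
  qed
qed

text \<open>Minimality is the lower bound with the nonnegative slack dropped. For uniqueness the
  slack is kept: a measure doing at least as well as \<open>\<mu>\<close> has couplings with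
  \<open>D k\<close> of arbitrarily small slack, and so does \<open>\<mu>\<close> itself.\<close>

lemma Bary_eq_singleton:
  fixes \<mu> :: "'a::euclidean_space measure" and D :: "'m::finite \<Rightarrow> 'a measure" and l :: "real ^ 'm"
  assumes prob: "\<mu> \<in> prob_measures" "\<And>j. D j \<in> prob_measures"
    and mom: "finite_second_moment \<mu>" "\<And>j. finite_second_moment (D j)"
    and \<Omega>: "open \<Omega>" "convex \<Omega>" "\<Omega> = UNIV \<or> bounded \<Omega>"
    and supp: "supported_on \<mu> \<Omega>" "\<And>j. supported_on (D j) \<Omega>"
    and dens: "\<And>j. g j \<in> borel_measurable borel" "\<And>j. D j = density lborel (\<lambda>x. ennreal (g j x))"
      "\<And>j. bdd_above (range (g j))"
    and T: "\<And>j. optimal_transport_map \<mu> (D j) (T j)"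
    and l: "l \<in> prob_simplex"
    and avg: "AE x in \<mu>. (\<Sum>j\<in>UNIV. l $ j *\<^sub>R T j x) = x"
  shows "Bary D l = {\<mu>}"
proof -
  have l0: "\<And>j. 0 \<le> l $ j" and l1: "(\<Sum>j\<in>UNIV. l $ j) = 1"
    using l by (auto simp: prob_simplex_def)
  obtain \<phi> \<psi> :: "'m \<Rightarrow> 'a \<Rightarrow> real" where
    cvx: "\<And>j. convex_on \<Omega> (\<psi> j)"
    and m: "\<And>j. \<psi> j \<in> borel_measurable borel" "\<And>j. \<phi> j \<in> borel_measurable borel"
    and young: "\<And>j y z. y \<in> \<Omega> \<Longrightarrow> y \<bullet> z \<le> \<phi> j z + \<psi> j y"
    and int: "\<And>\<nu> \<pi> j. finite_second_moment \<nu> \<Longrightarrow> \<nu> \<in> prob_measures \<Longrightarrow> \<pi> \<in> couplings (D j) \<nu> \<Longrightarrow>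
       integrable \<pi> (\<lambda>p. l $ j * (\<phi> j (snd p) + \<psi> j (fst p) - fst p \<bullet> snd p))"
    and lower: "\<And>\<nu> \<pi>. finite_second_moment \<nu> \<Longrightarrow> \<nu> \<in> prob_measures \<Longrightarrow> (\<And>j. \<pi> j \<in> couplings (D j) \<nu>) \<Longrightarrow>
       (\<Sum>j\<in>UNIV. l $ j * (\<integral>x. (norm (T j x - x))\<^sup>2 \<partial>\<mu>))
         + 2 * (\<Sum>j\<in>UNIV. \<integral>p. l $ j * (\<phi> j (snd p) + \<psi> j (fst p) - fst p \<bullet> snd p) \<partial>(\<pi> j))
       \<le> (\<Sum>j\<in>UNIV. l $ j * (\<integral>p. (norm (fst p - snd p))\<^sup>2 \<partial>(\<pi> j)))"
    by (rule barycenter_lower_bound[OF prob mom \<Omega> supp T l0 l1 avg]) blast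
  note TD = optimal_transport_mapD[OF T prob(1) mom]
  define J where "J \<nu> = (\<Sum>j\<in>UNIV. ennreal (l $ j) * W2sq (D j) \<nu>)" for \<nu>
  define V where "V = (\<Sum>j\<in>UNIV. l $ j * (\<integral>x. (norm (T j x - x))\<^sup>2 \<partial>\<mu>))"
  have V0: "V \<ge> 0" unfolding V_def by (intro sum_nonneg mult_nonneg_nonneg l0) simp
  have J\<mu>: "J \<mu> = ennreal V"
  proof -
    have "J \<mu> = (\<Sum>j\<in>UNIV. ennreal (l $ j * (\<integral>x. (norm (T j x - x))\<^sup>2 \<partial>\<mu>)))"
      unfolding J_def using l0 by (simp add: TD(6) ennreal_mult')
    also have "\<dots> = ennreal V"
      unfolding V_def using l0 by (intro sum_ennreal) auto
    finally show ?thesis .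
  qed
  \<comment> \<open>A positive weight is needed twice: finiteness of \<open>J \<nu>\<close> then
    bounds the cost to \<open>D k\<close>, giving \<open>\<nu>\<close> a second moment, and the
    slack bound is divided by \<open>l $ k\<close>.\<close>
  obtain k where k: "l $ k > 0"
  proof -
    have "\<exists>k. l $ k \<noteq> 0" using l1 by (metis sum.neutral zero_neq_one)
    with l0 that show thesis by (metis less_eq_real_def)
  qed
  have D\<Omega>: "AE y in D j. y \<in> \<Omega>" for j using supp(2)[of j] by (simp add: supported_on_def)
  define s where "s j p = \<phi> j (snd p) + \<psi> j (fst p) - fst p \<bullet> snd p" for j and p :: "'a \<times> 'a"
  have s_AE: "AE p in \<pi>. 0 \<le> s j p" if "\<pi> \<in> couplings (D j) \<nu>" for j \<pi> \<nu>
  proof -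
    note c = couplingsD[OF that]
    have "AE p in \<pi>. fst p \<in> \<Omega>"
      using D\<Omega>[of j] unfolding c(2)[symmetric] by (rule AE_distrD[OF c(4)])
    then show ?thesis by eventually_elim (simp add: s_def young)
  qed
  \<comment> \<open>A coupling within \<epsilon> of the infimum is taken for every index; the
    weights sum to 1, so the total excess is again at most \<epsilon>. All slack integrals are
    nonnegative, so the total controls the one for \<open>k\<close>.\<close>
  have near_optimal: "V \<le> enn2real (J \<nu>) + \<epsilon> \<and>
      (\<exists>\<pi>\<in>couplings (D k) \<nu>. (\<integral>\<^sup>+ p. ennreal (s k p) \<partial>\<pi>) \<le> ennreal ((enn2real (J \<nu>) + \<epsilon> - V) / (2 * l $ k)))"
    if \<nu>: "\<nu> \<in> prob_measures" and fin: "J \<nu> < \<infinity>" and \<epsilon>: "\<epsilon> > 0" for \<nu> \<epsilon>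
  proof -
    have "ennreal (l $ k) * W2sq (D k) \<nu> \<le> J \<nu>"
      unfolding J_def by (rule member_le_sum) auto
    then have "ennreal (l $ k) * W2sq (D k) \<nu> < \<infinity>" using fin by (rule le_less_trans)
    then have "W2sq (D k) \<nu> < \<infinity>" using k by (auto simp: ennreal_mult_less_top)
    then have \<nu>m: "finite_second_moment \<nu>" by (rule finite_second_moment_of_W2sq[OF mom(2)])
    define w where "w j = enn2real (W2sq (D j) \<nu>)" for j
    have w: "W2sq (D j) \<nu> = ennreal (w j)" for j
      using W2sq_finite[OF prob(2) \<nu> mom(2) \<nu>m, of j] by (simp add: w_def)
    have w0: "w j \<ge> 0" for j by (simp add: w_def)
    have Jw: "enn2real (J \<nu>) = (\<Sum>j\<in>UNIV. l $ j * w j)"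
    proof -
      have "J \<nu> = ennreal (\<Sum>j\<in>UNIV. l $ j * w j)"
        unfolding J_def w using l0 w0 by (simp add: ennreal_mult[symmetric] sum_ennreal)
      then show ?thesis using l0 w0 by (simp add: sum_nonneg)
    qed
    have "\<exists>\<pi>. \<pi> \<in> couplings (D j) \<nu> \<and> (\<integral>p. (norm (fst p - snd p))\<^sup>2 \<partial>\<pi>) \<le> w j + \<epsilon>" for j
    proof -
      have "W2sq (D j) \<nu> < ennreal (w j + \<epsilon>)"
        unfolding w using w0[of j] \<epsilon> by (intro ennreal_lessI) auto
      then obtain \<pi> where \<pi>: "\<pi> \<in> couplings (D j) \<nu>"
        "(\<integral>\<^sup>+ (x, y). ennreal ((norm (x - y))\<^sup>2) \<partial>\<pi>) < ennreal (w j + \<epsilon>)"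
        unfolding W2sq_def INF_less_iff by blast
      then have "(\<integral>p. (norm (fst p - snd p))\<^sup>2 \<partial>\<pi>) < w j + \<epsilon>"
        unfolding coupling_L2(4)[OF \<pi>(1) mom(2) \<nu>m] by (simp add: ennreal_less_iff)
      with \<pi>(1) show ?thesis by auto
    qed
    then obtain \<pi> where \<pi>: "\<And>j. \<pi> j \<in> couplings (D j) \<nu>"
      "\<And>j. (\<integral>p. (norm (fst p - snd p))\<^sup>2 \<partial>(\<pi> j)) \<le> w j + \<epsilon>" by metis
    have nn: "0 \<le> (\<integral>p. l $ j * s j p \<partial>(\<pi> j))" for j
      using s_AE[OF \<pi>(1)[of j]] l0[of j] by (intro integral_nonneg_AE) auto
    have "V + 2 * (\<integral>p. l $ k * s k p \<partial>(\<pi> k)) \<le> V + 2 * (\<Sum>j\<in>UNIV. \<integral>p. l $ j * s j p \<partial>(\<pi> j))"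
      using nn member_le_sum[of k UNIV "\<lambda>j. \<integral>p. l $ j * s j p \<partial>(\<pi> j)"] by simp
    also have "\<dots> \<le> (\<Sum>j\<in>UNIV. l $ j * (\<integral>p. (norm (fst p - snd p))\<^sup>2 \<partial>(\<pi> j)))"
      unfolding V_def s_def using \<nu>m \<nu> \<pi>(1) by (rule lower)
    also have "\<dots> \<le> (\<Sum>j\<in>UNIV. l $ j * (w j + \<epsilon>))"
      using l0 \<pi>(2) by (intro sum_mono mult_left_mono) auto
    also have "\<dots> = enn2real (J \<nu>) + \<epsilon>"
      using l1 by (simp add: Jw distrib_left sum.distrib sum_distrib_right[symmetric])
    finally have le: "V + 2 * (\<integral>p. l $ k * s k p \<partial>(\<pi> k)) \<le> enn2real (J \<nu>) + \<epsilon>" .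
    have "integrable (\<pi> k) (\<lambda>p. l $ k * s k p)"
      using int[OF \<nu>m \<nu> \<pi>(1)[of k]] by (simp add: s_def)
    then have "integrable (\<pi> k) (s k)" using k by simp
    then have "(\<integral>\<^sup>+ p. ennreal (s k p) \<partial>(\<pi> k)) = ennreal (\<integral>p. s k p \<partial>(\<pi> k))"
      using s_AE[OF \<pi>(1)[of k]] by (rule nn_integral_eq_integral)
    also have "\<dots> \<le> ennreal ((enn2real (J \<nu>) + \<epsilon> - V) / (2 * l $ k))"
      using le k by (intro ennreal_leI) (simp add: field_simps)
    finally show ?thesis using \<pi>(1)[of k] le nn[of k] by auto
  qed
  have min: "J \<mu> \<le> J \<nu>" if \<nu>: "\<nu> \<in> prob_measures" for \<nu>
  proof (cases "J \<nu> < \<infinity>")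
    case True
    have "V \<le> enn2real (J \<nu>)"
      by (rule field_le_epsilon) (rule near_optimal[OF \<nu> True, THEN conjunct1])
    then have "ennreal V \<le> ennreal (enn2real (J \<nu>))" by (rule ennreal_leI)
    also have "ennreal (enn2real (J \<nu>)) = J \<nu>" using True by simp
    finally show ?thesis by (simp add: J\<mu>)
  next
    case False
    then show ?thesis by (simp add: top.not_eq_extremum[symmetric])
  qed
  \<comment> \<open>The excess \<open>2 * l $ k * \<eta>\<close> is what \<open>near_optimal\<close>
    turns into slack \<open>\<eta>\<close> once \<open>J \<nu>\<close> is at most
    \<open>V\<close>.\<close>
  have small: "\<exists>\<pi>\<in>couplings (D k) \<nu>. (\<integral>\<^sup>+ (y, z). ennreal (\<phi> k z + \<psi> k y - y \<bullet> z) \<partial>\<pi>) \<le> ennreal \<eta>"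
    if \<nu>: "\<nu> \<in> prob_measures" "J \<nu> \<le> J \<mu>" and \<eta>: "\<eta> > 0" for \<nu> \<eta>
  proof -
    have fin: "J \<nu> < \<infinity>" using \<nu>(2) J\<mu> by (metis ennreal_less_top infinity_ennreal_def le_less_trans)
    have "enn2real (J \<nu>) \<le> V"
      using \<nu>(2) V0 unfolding J\<mu> by (rule enn2real_leI[rotated])
    moreover obtain \<pi> where \<pi>: "\<pi> \<in> couplings (D k) \<nu>"
      "(\<integral>\<^sup>+ p. ennreal (s k p) \<partial>\<pi>) \<le> ennreal ((enn2real (J \<nu>) + 2 * l $ k * \<eta> - V) / (2 * l $ k))"
      using near_optimal[OF \<nu>(1) fin, of "2 * l $ k * \<eta>"] k \<eta> by auto
    ultimately have "(\<integral>\<^sup>+ p. ennreal (s k p) \<partial>\<pi>) \<le> ennreal \<eta>"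
      using k by (elim order_trans, intro ennreal_leI) (simp add: field_simps)
    with \<pi>(1) show ?thesis unfolding s_def case_prod_beta by blast
  qed
  obtain B where B: "\<And>x. g k x \<le> B"
    using dens(3)[of k] by (auto simp: bdd_above_def)
  have unique: "\<nu> = \<mu>" if \<nu>: "\<nu> \<in> prob_measures" "J \<nu> \<le> J \<mu>" for \<nu>
  proof (rule measure_eqI_Lipschitz[OF \<nu>(1) prob(1)])
    fix u :: "'a \<Rightarrow> real" and M L
    assume u: "\<And>x. \<bar>u x\<bar> \<le> M" "\<And>x y. \<bar>u x - u y\<bar> \<le> L * dist x y" "u \<in> borel_measurable borel"
    have "\<bar>(\<integral>x. u x \<partial>\<nu>) - (\<integral>x. u x \<partial>\<mu>)\<bar> \<le> 0 + \<epsilon>" if \<epsilon>: "\<epsilon> > 0" for \<epsilon>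
    proof -
      have "\<epsilon> / 2 > 0" using \<epsilon> by simp
      show ?thesis
      proof (rule coupling_slack_determines_integral[where D = "D k" and g = "g k" and \<phi> = "\<phi> k"
            and \<psi> = "\<psi> k" and B = B and \<Omega> = \<Omega> and u = u and M = M and L = L and \<epsilon> = "\<epsilon> / 2",
            OF prob(2) dens(2,1) B D\<Omega> \<Omega>(1) cvx m young u \<open>\<epsilon> / 2 > 0\<close>])
        fix I \<eta> assume I: "\<eta> > 0"
          "\<And>\<nu> \<pi>. \<pi> \<in> couplings (D k) \<nu> \<Longrightarrow>
            (\<integral>\<^sup>+ (y, z). ennreal (\<phi> k z + \<psi> k y - y \<bullet> z) \<partial>\<pi>) \<le> ennreal \<eta> \<Longrightarrow> \<bar>(\<integral>x. u x \<partial>\<nu>) - I\<bar> \<le> \<epsilon> / 2"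
        \<comment> \<open>The same \<open>I\<close> serves both measures.\<close>
        have "\<bar>(\<integral>x. u x \<partial>\<nu>) - I\<bar> \<le> \<epsilon> / 2" using small[OF \<nu> I(1)] I(2) by blast
        moreover have "\<bar>(\<integral>x. u x \<partial>\<mu>) - I\<bar> \<le> \<epsilon> / 2" using small[OF prob(1) order_refl I(1)] I(2) by blast
        ultimately show ?thesis by linarith
      qed
    qed
    then have "\<bar>(\<integral>x. u x \<partial>\<nu>) - (\<integral>x. u x \<partial>\<mu>)\<bar> \<le> 0" by (rule field_le_epsilon)
    then show "(\<integral>x. u x \<partial>\<nu>) = (\<integral>x. u x \<partial>\<mu>)" by simp
  qed
  show ?thesis
  proof (intro equalityI subsetI)
    fix \<nu> assume "\<nu> \<in> Bary D l"
    then have "\<nu> \<in> prob_measures" "\<not> J \<mu> < J \<nu>"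
      using prob(1) by (auto simp: Bary_def argmin_set_def is_arg_min_def J_def)
    then show "\<nu> \<in> {\<mu>}" using unique by (simp add: not_less)
  next
    fix \<nu> assume "\<nu> \<in> {\<mu>}"
    then show "\<nu> \<in> Bary D l"
      using prob(1) min by (auto simp: Bary_def argmin_set_def is_arg_min_def J_def not_less)
  qed
qed

section \<open>Averages of the transport maps: variance identity and Gram matrix\<close>

text \<open>The parallel axis identity: mean squared distance to \<open>x\<close> is variance plus
  squared distance of the mean to \<open>x\<close>. Both sums come from one expansion, taken at
  \<open>x\<close> and at the mean.\<close>

lemma weighted_variance:
  fixes y :: "'m \<Rightarrow> 'a::real_inner"
  assumes "finite I" "(\<Sum>j\<in>I. l j) = 1"
  shows "(\<Sum>j\<in>I. l j * (norm (y j - x))\<^sup>2) =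
    (\<Sum>j\<in>I. l j * (norm (y j - (\<Sum>i\<in>I. l i *\<^sub>R y i)))\<^sup>2) + (norm ((\<Sum>i\<in>I. l i *\<^sub>R y i) - x))\<^sup>2"
proof -
  define S where "S = (\<Sum>i\<in>I. l i *\<^sub>R y i)"
  have e: "(\<Sum>j\<in>I. l j * (norm (y j - a))\<^sup>2) = (\<Sum>j\<in>I. l j * (norm (y j))\<^sup>2) + (norm a)\<^sup>2 - 2 * (S \<bullet> a)" for a
  proof -
    have "(\<Sum>j\<in>I. l j * (y j \<bullet> a)) = S \<bullet> a" by (simp add: S_def inner_sum_left)
    then show ?thesis
      unfolding norm_diff_squared
      by (simp add: ring_distribs sum.distrib sum_subtractf sum_distrib_right[symmetric] assms
          mult.left_commute[of _ 2] sum_distrib_left[symmetric])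
  qed
  show ?thesis
    unfolding S_def[symmetric] e norm_diff_squared[of S x] by (simp add: power2_norm_eq_inner)
qed

text \<open>Dropping the variance term bounds the squared displacement of the average by the average
  of the squared displacements.\<close>

lemma average_displacement_L2:
  fixes \<mu> :: "'a::euclidean_space measure" and T :: "'m::finite \<Rightarrow> 'a \<Rightarrow> 'a"
  assumes \<mu>: "sets \<mu> = sets borel" and l: "\<And>j. 0 \<le> l j" "(\<Sum>j\<in>UNIV. l j) = 1"
    and Tm: "\<And>j. T j \<in> borel_measurable \<mu>" and Ti: "\<And>j. integrable \<mu> (\<lambda>x. (norm (T j x - x))\<^sup>2)"
  shows "integrable \<mu> (\<lambda>x. (norm ((\<Sum>j\<in>UNIV. l j *\<^sub>R T j x) - x))\<^sup>2)"
proof (rule Bochner_Integration.integrable_bound)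
  show "integrable \<mu> (\<lambda>x. \<Sum>j\<in>UNIV. l j * (norm (T j x - x))\<^sup>2)" using Ti by auto
  note [measurable_cong] = \<mu> and [measurable] = Tm
  show "(\<lambda>x. (norm ((\<Sum>j\<in>UNIV. l j *\<^sub>R T j x) - x))\<^sup>2) \<in> borel_measurable \<mu>" by measurable
  show "AE x in \<mu>. norm ((norm ((\<Sum>j\<in>UNIV. l j *\<^sub>R T j x) - x))\<^sup>2) \<le> norm (\<Sum>j\<in>UNIV. l j * (norm (T j x - x))\<^sup>2)"
    using l(1) by (subst weighted_variance[OF finite l(2)]) (intro AE_I2, simp add: sum_nonneg)
qed

text \<open>By the variance identity, moving \<open>\<mu>\<close> to its image under the average
  \<open>S\<close> would lower the objective by at least the integral of
  \<open>(norm (S x - x))\<^sup>2\<close>.\<close>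

lemma average_eq_id_of_Bary:
  fixes \<mu> :: "'a::euclidean_space measure" and D :: "'m::finite \<Rightarrow> 'a measure" and l :: "real ^ 'm"
  assumes prob: "\<mu> \<in> prob_measures"
    and mom: "finite_second_moment \<mu>" "\<And>j. finite_second_moment (D j)"
    and T: "\<And>j. optimal_transport_map \<mu> (D j) (T j)"
    and l: "l \<in> prob_simplex" and Bary: "\<mu> \<in> Bary D l"
  shows "AE x in \<mu>. (\<Sum>j\<in>UNIV. l $ j *\<^sub>R T j x) = x"
proof -
  have l0: "\<And>j. 0 \<le> l $ j" and l1: "(\<Sum>j\<in>UNIV. l $ j) = 1"
    using l by (auto simp: prob_simplex_def)
  interpret \<mu>: prob_space \<mu> using prob by (rule prob_measuresD)
  have [simp, measurable_cong]: "sets \<mu> = sets borel" using prob by (rule prob_measuresD)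
  note TD = optimal_transport_mapD[OF T prob mom]
  note [measurable] = TD(1)
  define S where "S x = (\<Sum>j\<in>UNIV. l $ j *\<^sub>R T j x)" for x
  have Sm[measurable]: "S \<in> borel_measurable \<mu>" unfolding S_def by measurable
  have iS: "integrable \<mu> (\<lambda>x. (norm (S x - x))\<^sup>2)"
    unfolding S_def by (rule average_displacement_L2[OF _ l0 l1 TD(1) TD(4)]) simp
  have iTS: "integrable \<mu> (\<lambda>x. (norm (T j x - S x))\<^sup>2)" for j
  proof -
    have "integrable \<mu> (\<lambda>x. (norm ((T j x - x) - (S x - x)))\<^sup>2)"
      by (rule integrable_norm_diff_L2[OF _ _ TD(4) iS]) measurable
    then show ?thesis by simp
  qed
  define \<nu> where "\<nu> = distr \<mu> borel S"
  have \<nu>: "\<nu> \<in> prob_measures"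
    unfolding prob_measures_def \<nu>_def using \<mu>.prob_space_distr[OF Sm] by simp
  have W\<nu>: "W2sq (D j) \<nu> \<le> ennreal (\<integral>x. (norm (T j x - S x))\<^sup>2 \<partial>\<mu>)" for j
  proof -
    have pm: "(\<lambda>x. (T j x, S x)) \<in> borel_measurable \<mu>" by measurable
    have "distr \<mu> borel (\<lambda>x. (T j x, S x)) \<in> couplings (D j) \<nu>"
      using \<mu>.prob_space_distr[OF pm]
      by (auto simp: couplings_def prob_measures_def distr_distr pm comp_def \<nu>_def TD(2))
    then have "W2sq (D j) \<nu> \<le> (\<integral>\<^sup>+ (x, y). ennreal ((norm (x - y))\<^sup>2) \<partial>distr \<mu> borel (\<lambda>x. (T j x, S x)))"
      unfolding W2sq_def by (rule INF_lower)
    also have "\<dots> = (\<integral>\<^sup>+ x. ennreal ((norm (T j x - S x))\<^sup>2) \<partial>\<mu>)"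
      unfolding case_prod_beta by (subst nn_integral_distr[OF pm]) auto
    also have "\<dots> = ennreal (\<integral>x. (norm (T j x - S x))\<^sup>2 \<partial>\<mu>)"
      by (rule nn_integral_eq_integral[OF iTS]) simp
    finally show ?thesis .
  qed
  have "\<not> (\<Sum>j\<in>UNIV. ennreal (l $ j) * W2sq (D j) \<nu>) < (\<Sum>j\<in>UNIV. ennreal (l $ j) * W2sq (D j) \<mu>)"
    using Bary \<nu> by (auto simp: Bary_def argmin_set_def is_arg_min_def)
  then have "(\<Sum>j\<in>UNIV. ennreal (l $ j) * W2sq (D j) \<mu>) \<le> (\<Sum>j\<in>UNIV. ennreal (l $ j) * W2sq (D j) \<nu>)"
    by (simp add: not_less)
  also have "\<dots> \<le> (\<Sum>j\<in>UNIV. ennreal (l $ j) * ennreal (\<integral>x. (norm (T j x - S x))\<^sup>2 \<partial>\<mu>))"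
    by (intro sum_mono mult_left_mono W\<nu>) auto
  finally have "ennreal (\<Sum>j\<in>UNIV. l $ j * (\<integral>x. (norm (T j x - x))\<^sup>2 \<partial>\<mu>))
     \<le> ennreal (\<Sum>j\<in>UNIV. l $ j * (\<integral>x. (norm (T j x - S x))\<^sup>2 \<partial>\<mu>))"
    using l0 by (simp add: TD(6) ennreal_mult[symmetric] sum_ennreal)
  then have le: "(\<Sum>j\<in>UNIV. l $ j * (\<integral>x. (norm (T j x - x))\<^sup>2 \<partial>\<mu>))
     \<le> (\<Sum>j\<in>UNIV. l $ j * (\<integral>x. (norm (T j x - S x))\<^sup>2 \<partial>\<mu>))"
    using l0 by (subst (asm) ennreal_le_iff) (auto intro!: sum_nonneg)
  have "(\<Sum>j\<in>UNIV. l $ j * (\<integral>x. (norm (T j x - x))\<^sup>2 \<partial>\<mu>)) = (\<integral>x. (\<Sum>j\<in>UNIV. l $ j * (norm (T j x - x))\<^sup>2) \<partial>\<mu>)"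
    using TD(4) by (subst Bochner_Integration.integral_sum) auto
  also have "\<dots> = (\<integral>x. (\<Sum>j\<in>UNIV. l $ j * (norm (T j x - S x))\<^sup>2) + (norm (S x - x))\<^sup>2 \<partial>\<mu>)"
    unfolding S_def by (intro Bochner_Integration.integral_cong refl weighted_variance finite l1)
  also have "\<dots> = (\<Sum>j\<in>UNIV. l $ j * (\<integral>x. (norm (T j x - S x))\<^sup>2 \<partial>\<mu>)) + (\<integral>x. (norm (S x - x))\<^sup>2 \<partial>\<mu>)"
    using iTS iS by (subst Bochner_Integration.integral_add) (auto simp: Bochner_Integration.integral_sum)
  finally have "(\<integral>x. (norm (S x - x))\<^sup>2 \<partial>\<mu>) \<le> 0" using le by simp
  then have "(\<integral>x. (norm (S x - x))\<^sup>2 \<partial>\<mu>) = 0" by (intro antisym) auto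
  then have "AE x in \<mu>. (norm (S x - x))\<^sup>2 = 0"
    using integral_nonneg_eq_0_iff_AE[OF iS] by simp
  then show ?thesis by eventually_elim (simp add: S_def)
qed

text \<open>Since the weights sum to 1, averaged displacements are the displacement of the average,
  so component \<open>j\<close> of \<open>A *v l\<close> is the integral of
  \<open>(T j x - x) \<bullet> (S x - x)\<close>. Pairing with \<open>l\<close> gives the squared
  norm of \<open>S x - x\<close>, which yields one direction; the other is read off the
  components.\<close>

lemma Gram_matrix_kernel_iff:
  fixes \<mu> :: "'a::euclidean_space measure" and T :: "'m::finite \<Rightarrow> 'a \<Rightarrow> 'a" and A :: "real ^ 'm ^ 'm"
  assumes \<mu>: "sets \<mu> = sets borel" and l: "l \<in> prob_simplex"
    and Tm: "\<And>j. T j \<in> borel_measurable \<mu>" and Ti: "\<And>j. integrable \<mu> (\<lambda>x. (norm (T j x - x))\<^sup>2)"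
    and A: "\<And>j i. A $ j $ i = (\<integral>x. (T j x - x) \<bullet> (T i x - x) \<partial>\<mu>)"
  shows "A *v l = 0 \<longleftrightarrow> (AE x in \<mu>. (\<Sum>j\<in>UNIV. l $ j *\<^sub>R T j x) = x)"
proof -
  have l0: "\<And>j. 0 \<le> l $ j" and l1: "(\<Sum>j\<in>UNIV. l $ j) = 1"
    using l by (auto simp: prob_simplex_def)
  note [measurable_cong] = \<mu> and [measurable] = Tm
  define S where "S x = (\<Sum>j\<in>UNIV. l $ j *\<^sub>R T j x)" for x
  have [measurable]: "S \<in> borel_measurable \<mu>" unfolding S_def by measurable
  have iS: "integrable \<mu> (\<lambda>x. (norm (S x - x))\<^sup>2)"
    unfolding S_def by (rule average_displacement_L2[OF \<mu> l0 l1 Tm Ti])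
  have sum: "(\<Sum>j\<in>UNIV. l $ j *\<^sub>R (T j x - x)) = S x - x" for x
    by (simp add: S_def scaleR_diff_right sum_subtractf scaleR_left.sum[symmetric] l1)
  have iT: "integrable \<mu> (\<lambda>x. (T j x - x) \<bullet> (T i x - x))" for i j
    by (rule integrable_inner_L2[OF _ _ Ti Ti]) measurable
  have iTS: "integrable \<mu> (\<lambda>x. (T j x - x) \<bullet> (S x - x))" for j
    by (rule integrable_inner_L2[OF _ _ Ti iS]) measurable
  have Al: "(A *v l) $ j = (\<integral>x. (T j x - x) \<bullet> (S x - x) \<partial>\<mu>)" for j
  proof -
    have "(A *v l) $ j = (\<Sum>i\<in>UNIV. \<integral>x. l $ i * ((T j x - x) \<bullet> (T i x - x)) \<partial>\<mu>)"
      by (simp add: matrix_vector_mult_def A mult.commute)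
    also have "\<dots> = (\<integral>x. (\<Sum>i\<in>UNIV. l $ i * ((T j x - x) \<bullet> (T i x - x))) \<partial>\<mu>)"
      using iT by (intro Bochner_Integration.integral_sum[symmetric]) auto
    also have "\<dots> = (\<integral>x. (T j x - x) \<bullet> (S x - x) \<partial>\<mu>)"
      unfolding sum[symmetric] by (simp add: inner_sum_right)
    finally show ?thesis .
  qed
  show ?thesis
  proof
    assume "A *v l = 0"
    then have "0 = (\<Sum>j\<in>UNIV. l $ j * (A *v l) $ j)" by simp
    also have "\<dots> = (\<Sum>j\<in>UNIV. \<integral>x. l $ j * ((T j x - x) \<bullet> (S x - x)) \<partial>\<mu>)"
      by (simp add: Al)
    also have "\<dots> = (\<integral>x. (\<Sum>j\<in>UNIV. l $ j * ((T j x - x) \<bullet> (S x - x))) \<partial>\<mu>)"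
      using iTS by (intro Bochner_Integration.integral_sum[symmetric]) auto
    also have "\<dots> = (\<integral>x. (norm (S x - x))\<^sup>2 \<partial>\<mu>)"
    proof -
      have "(\<Sum>j\<in>UNIV. l $ j * ((T j x - x) \<bullet> (S x - x))) = (\<Sum>j\<in>UNIV. l $ j *\<^sub>R (T j x - x)) \<bullet> (S x - x)" for x
        by (simp add: inner_sum_left)
      then show ?thesis by (simp add: sum power2_norm_eq_inner)
    qed
    finally have "AE x in \<mu>. (norm (S x - x))\<^sup>2 = 0"
      using integral_nonneg_eq_0_iff_AE[OF iS] by simp
    then show "AE x in \<mu>. (\<Sum>j\<in>UNIV. l $ j *\<^sub>R T j x) = x"
      by eventually_elim (simp add: S_def)
  next
    assume "AE x in \<mu>. (\<Sum>j\<in>UNIV. l $ j *\<^sub>R T j x) = x"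
    then have "AE x in \<mu>. (T j x - x) \<bullet> (S x - x) = 0" for j
      by eventually_elim (simp add: S_def)
    then have "(A *v l) $ j = 0" for j
      unfolding Al by (rule integral_eq_zero_AE)
    then show "A *v l = 0" by (simp add: vec_eq_iff)
  qed
qed

text \<open>As \<open>Bary\<close> is a set of minimizers, the constraint that \<open>\<mu>\<close>
  is the barycenter becomes equality with a singleton and so includes uniqueness. The first
  objective takes extended nonnegative values, the second is real.\<close>

theorem proposition1:
  fixes \<mu> :: "(real ^ 'd) measure"
    and D :: "'m::finite \<Rightarrow> (real ^ 'd) measure"
    and \<Omega> :: "(real ^ 'd) set"
    and g :: "real ^ 'd \<Rightarrow> real"
    and gD :: "'m \<Rightarrow> real ^ 'd \<Rightarrow> real"
    and T :: "'m \<Rightarrow> real ^ 'd \<Rightarrow> real ^ 'd"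
    and c :: "real ^ 'm"
    and A :: "real ^ 'm ^ 'm"
  assumes prob: "\<mu> \<in> prob_measures" "\<And>j. D j \<in> prob_measures"
    and moments: "finite_second_moment \<mu>" "\<And>j. finite_second_moment (D j)"
    and A1_ac: "absolutely_continuous lborel \<mu>" "\<And>j. absolutely_continuous lborel (D j)"
    and A1_Omega: "\<Omega> = UNIV \<or> (bounded \<Omega> \<and> open \<Omega> \<and> convex \<Omega>)"
    and A1_supp: "supported_on \<mu> \<Omega>" "\<And>j. supported_on (D j) \<Omega>"
    and A2_dens_mu: "g \<in> borel_measurable borel" "\<And>x. 0 \<le> g x"
          "\<mu> = density lborel (\<lambda>x. ennreal (g x))"
    and A2_dens_D: "\<And>j. gD j \<in> borel_measurable borel" "\<And>j x. 0 \<le> gD j x"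
          "\<And>j. D j = density lborel (\<lambda>x. ennreal (gD j x))"
    and A2_bdd: "bdd_above (range g)" "\<And>j. bdd_above (range (gD j))"
    and A2_pos: "\<And>j x. x \<in> \<Omega> \<Longrightarrow> 0 < gD j x"
    and A3: "if \<Omega> = UNIV
             then locally_Hoelder g \<and> (\<forall>j. locally_Hoelder (gD j))
             else (\<exists>\<epsilon>>0. \<forall>x\<in>\<Omega>. \<epsilon> \<le> g x) \<and> (\<forall>j. \<exists>\<epsilon>>0. \<forall>x\<in>\<Omega>. \<epsilon> \<le> gD j x)"
    and T: "\<And>j. optimal_transport_map \<mu> (D j) (T j)"
    and c: "\<And>j. c $ j = enn2real (W2sq (D j) \<mu>)"
    and A: "\<And>j l. A $ j $ l = (\<integral>x. (T j x - x) \<bullet> (T l x - x) \<partial>\<mu>)"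
  shows "argmin_set (\<lambda>l. \<Sum>j\<in>UNIV. ennreal (l $ j) * W2sq (D j) \<mu>)
           {l \<in> prob_simplex. Bary D l = {\<mu>}}
       = argmin_set (\<lambda>l. l \<bullet> c) {l \<in> prob_simplex. A *v l = 0}"
proof -
  have l_Bary: "Bary D l = {\<mu>} \<longleftrightarrow> A *v l = 0" if l: "l \<in> prob_simplex" for l :: "real ^ 'm"
  proof -
    have \<Omega>: "open \<Omega>" "convex \<Omega>" "\<Omega> = UNIV \<or> bounded \<Omega>"
      using A1_Omega by auto
    note TD = optimal_transport_mapD[OF T prob(1) moments]
    have kernel: "A *v l = 0 \<longleftrightarrow> (AE x in \<mu>. (\<Sum>j\<in>UNIV. l $ j *\<^sub>R T j x) = x)"
      by (rule Gram_matrix_kernel_iff[OF prob_measuresD(2)[OF prob(1)] l TD(1) TD(4) A])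
    show ?thesis
      unfolding kernel
    proof
      assume "Bary D l = {\<mu>}"
      then show "AE x in \<mu>. (\<Sum>j\<in>UNIV. l $ j *\<^sub>R T j x) = x"
        by (intro average_eq_id_of_Bary[OF prob(1) moments T l]) simp
    next
      assume "AE x in \<mu>. (\<Sum>j\<in>UNIV. l $ j *\<^sub>R T j x) = x"
      then show "Bary D l = {\<mu>}"
        by (rule Bary_eq_singleton[OF prob moments \<Omega> A1_supp A2_dens_D(1,3) A2_bdd(2) T l])
    qed
  qed
  then have feasible: "{l \<in> prob_simplex. Bary D l = {\<mu>}} = {l \<in> prob_simplex. A *v l = 0}"
    by blast
  have c0: "0 \<le> c $ j" for j by (simp add: c)
  have W: "W2sq (D j) \<mu> = ennreal (c $ j)" for j
    using W2sq_finite[OF prob(2,1) moments(2,1), of j] by (simp add: c)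
  \<comment> \<open>All costs are finite, so on the simplex the two objectives agree. Nonnegativity
    of \<open>l \<bullet> c\<close> is recorded because \<open>ennreal\<close> preserves strict
    comparisons only between nonnegative reals.\<close>
  have objective: "(\<Sum>j\<in>UNIV. ennreal (l $ j) * W2sq (D j) \<mu>) = ennreal (l \<bullet> c) \<and> 0 \<le> l \<bullet> c"
    if "l \<in> prob_simplex" for l :: "real ^ 'm"
  proof -
    have l0: "0 \<le> l $ j" for j using that by (simp add: prob_simplex_def)
    then have "(\<Sum>j\<in>UNIV. ennreal (l $ j) * W2sq (D j) \<mu>) = ennreal (l \<bullet> c)"
      unfolding W inner_vec_def using c0 by (simp add: ennreal_mult[symmetric] sum_ennreal)
    moreover have "0 \<le> l \<bullet> c"
      unfolding inner_vec_def using l0 c0 by (simp add: sum_nonneg)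
    ultimately show ?thesis ..
  qed
  show ?thesis
    unfolding feasible argmin_set_def is_arg_min_def
    using objective by (auto simp: ennreal_less_iff)
qed

end
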